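(* Let $d\geq 2$ be an integer, let $\alpha,\beta$ be arbitrary real numbers and let $l\geq 1$ be a natural number. For every tripartite state (density matrix) $\rho$ on $\mathbb{C}^{d}\otimes\mathbb{C}^{d}\otimes\mathbb{C}^{d}$, the GME concurrence satisfies $$C_{GME}(\rho)\geq\frac{1}{\sqrt{d(d-1)}}\left(\mathscr{M}(\rho)-\sqrt{(l\alpha^{2}+1)(l\beta^{2}+1)}-\frac{2(d-1)}{3}\right).$$
   Context: A state is a positive semidefinite complex matrix of trace $1$ on the given space. GME concurrence: for a pure state (unit vector) $|\varphi\rangle\in\mathbb{C}^d\otimes\mathbb{C}^d\otimes\mathbb{C}^d$, $C_{GME}(|\varphi\rangle)=\sqrt{\min\{1-\operatorname{tr}(\rho_1^2),\,1-\operatorname{tr}(\rho_2^2),\,1-\operatorname{tr}(\rho_3^2)\}}$, where $\rho_i$ is the reduced density matrix of subsystem $i$. For a mixed state, $C_{GME}(\rho)=\min\sum_i p_iC_{GME}(|\varphi_i\rangle)$, the minimum over all ensemble decompositions $\rho=\sum_i p_i|\varphi_i\rangle\langle\varphi_i|$ with $p_i\geq 0$, $\sum_i p_i=1$, and $|\varphi_i\rangle$ pure states. For $A=[a_{ij}]\in\mathbb{C}^{m\times n}$, $\operatorname{vec}(A)=(a_{11},\dots,a_{m1},a_{12},\dots,a_{m2},\dots,a_{1n},\dots,a_{mn})^T$ (column stacking), $T$ denotes transpose (no conjugation), and $\|A\|_{tr}=\operatorname{tr}\sqrt{A^\dagger A}$ is the trace norm. Realignment: if $Z$ is an $m\times m$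 block matrix with blocks $Z_{i,j}\in\mathbb{C}^{n\times n}$, then $\mathcal{R}(Z)$ is the $m^2\times n^2$ matrix whose rows are, in order, $\operatorname{vec}(Z_{1,1})^T,\dots,\operatorname{vec}(Z_{m,1})^T,\dots,\operatorname{vec}(Z_{1,m})^T,\dots,\operatorname{vec}(Z_{m,m})^T$. For a matrix $X$, $\omega_l(X)=(\operatorname{vec}(X),\dots,\operatorname{vec}(X))$ is the matrix with $l$ columns all equal to $\operatorname{vec}(X)$, and $E_{l\times l}$ is the $l\times l$ all-ones matrix. For a bipartite state $\rho$ on $\mathbb{C}^{d_A}\otimes\mathbb{C}^{d_B}$ (regarded as a $d_A\times d_A$ block matrix with $d_B\times d_B$ blocks), with partial traces $\operatorname{tr}_A,\operatorname{tr}_B$, define $$\mathcal{M}_{\alpha,\beta}^{l}(\rho)=\begin{pmatrix}\alpha\beta E_{l\times l} & \alpha\,\omega_l(\operatorname{tr}_A(\rho))^T\\ \beta\,\omega_l(\operatorname{tr}_B(\rho)) & \mathcal{R}(\rho)\end{pmatrix}.$$ For a tripartite state $\rho$ and $\{i,j,k\}=\{1,2,3\}$, $\mathscr{M}_{i|jk}(\rho)$ is the matrix $\mathcal{M}_{\alpha,\beta}^{l}(\rho)$ obtained by regarding $\rho$ (with tensor factors permuted accordingly) as a bipartite state with $A$ = subsystem $i$ and $B$ = joint subsystem $jk$. Finally $$\mathscr{M}(\rho)=\tfrac13\left(\|\mathscr{M}_{1|23}(\rho)\|_{tr}+\|\mathscr{M}_{2|13}(\rho)\|_{tr}+\|\mathscr{M}_{3|12}(\rho)\|_{tr}\right).$$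 *)

theory Defs
  imports "Jordan_Normal_Form.Schur_Decomposition"
begin

text \<open>All indices start at 0. A space of the form $C^m \otimes C^n$ is identified with $C^{mn}$ by
  the Kronecker ordering: the basis vector $e_i \otimes e_a$ has index \<open>i * n + a\<close>, so that an
  operator is an \<open>m\<close> by \<open>m\<close> block matrix with \<open>n\<close> by \<open>n\<close> blocks.\<close>

definition mat_trace :: "complex mat \<Rightarrow> complex" where
  "mat_trace A = (\<Sum>i<dim_row A. A $$ (i, i))"

text \<open>The order on complex numbers is the one of \<open>Complex_Order\<close>: \<open>0 \<le> z\<close> says that \<open>z\<close> is real
  and nonnegative. Over the complex numbers this forces the matrix to be Hermitian.\<close>

definition psd_mat :: "nat \<Rightarrow> complex mat \<Rightarrow> bool" where
  "psd_mat n A \<longleftrightarrow> A \<in> carrier_mat n n \<and> (\<forall>v \<in> carrier_vec n. 0 \<le> (A *\<^sub>v v) \<bullet>c v)"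

definition density_mat :: "nat \<Rightarrow> complex mat \<Rightarrow> bool" where
  "density_mat n \<rho> \<longleftrightarrow> psd_mat n \<rho> \<and> mat_trace \<rho> = 1"

definition psd_sqrt :: "complex mat \<Rightarrow> complex mat" where
  "psd_sqrt A = (THE B. psd_mat (dim_row A) B \<and> B * B = A)"

definition trace_norm :: "complex mat \<Rightarrow> real" where
  "trace_norm A = Re (mat_trace (psd_sqrt (mat_adjoint A * A)))"

definition vectorize :: "complex mat \<Rightarrow> complex vec" where
  "vectorize A = vec (dim_row A * dim_col A) (\<lambda>k. A $$ (k mod dim_row A, k div dim_row A))"

definition mat_block :: "nat \<Rightarrow> complex mat \<Rightarrow> nat \<Rightarrow> nat \<Rightarrow> complex mat" where
  "mat_block n Z i j = mat n n (\<lambda>(a, b). Z $$ (i * n + a, j * n + b))"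

text \<open>Row \<open>r\<close> belongs to the block in position \<open>(r mod m, r div m)\<close>: the blocks are listed column by
  column, as in \<open>vectorize\<close>.\<close>

definition realignment :: "nat \<Rightarrow> nat \<Rightarrow> complex mat \<Rightarrow> complex mat" where
  "realignment m n Z =
     mat_of_rows (n * n) (map (\<lambda>r. vectorize (mat_block n Z (r mod m) (r div m))) [0..<m * m])"

text \<open>Partial traces over the first factor (dimension \<open>m\<close>) and the second factor (dimension \<open>n\<close>).\<close>

definition ptrace_fst :: "nat \<Rightarrow> nat \<Rightarrow> complex mat \<Rightarrow> complex mat" where
  "ptrace_fst m n \<rho> = mat n n (\<lambda>(a, b). \<Sum>i<m. \<rho> $$ (i * n + a, i * n + b))"

definition ptrace_snd :: "nat \<Rightarrow> nat \<Rightarrow> complex mat \<Rightarrow> complex mat" where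
  "ptrace_snd m n \<rho> = mat m m (\<lambda>(i, j). \<Sum>a<n. \<rho> $$ (i * n + a, j * n + a))"

definition omega_mat :: "nat \<Rightarrow> complex mat \<Rightarrow> complex mat" where
  "omega_mat l X = mat_of_cols (dim_row X * dim_col X) (replicate l (vectorize X))"

definition ones_mat :: "nat \<Rightarrow> complex mat" where
  "ones_mat l = mat l l (\<lambda>_. 1)"

definition bipartite_M :: "real \<Rightarrow> real \<Rightarrow> nat \<Rightarrow> nat \<Rightarrow> nat \<Rightarrow> complex mat \<Rightarrow> complex mat" where
  "bipartite_M \<alpha> \<beta> l m n \<rho> = four_block_mat
     (complex_of_real (\<alpha> * \<beta>) \<cdot>\<^sub>m ones_mat l)
     (complex_of_real \<alpha> \<cdot>\<^sub>m transpose_mat (omega_mat l (ptrace_fst m n \<rho>)))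
     (complex_of_real \<beta> \<cdot>\<^sub>m omega_mat l (ptrace_snd m n \<rho>))
     (realignment m n \<rho>)"

text \<open>\<open>front_index d s\<close> sends the index of $e_x \otimes e_y \otimes e_z$, where \<open>x\<close> belongs to subsystem
  \<open>s\<close> (with \<open>s\<close> one of 1, 2, 3) and \<open>y\<close>, \<open>z\<close> to the other two subsystems in increasing order, to
  the index of the same basis vector in the original order of the tensor factors. Hence
  \<open>sub_to_front d s \<rho>\<close> is \<open>\<rho>\<close> with tensor factor \<open>s\<close> moved to the front.\<close>

definition tri_index :: "nat \<Rightarrow> nat \<Rightarrow> nat \<Rightarrow> nat \<Rightarrow> nat" where
  "tri_index d i j k = (i * d + j) * d + k"

definition front_index :: "nat \<Rightarrow> nat \<Rightarrow> nat \<Rightarrow> nat" where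
  "front_index d s r =
     (let x = r div d\<^sup>2; y = r div d mod d; z = r mod d
      in if s = 1 then tri_index d x y z
         else if s = 2 then tri_index d y x z
         else tri_index d y z x)"

definition sub_to_front :: "nat \<Rightarrow> nat \<Rightarrow> complex mat \<Rightarrow> complex mat" where
  "sub_to_front d s \<rho> = mat (d ^ 3) (d ^ 3) (\<lambda>(r, c). \<rho> $$ (front_index d s r, front_index d s c))"

definition reduced_state :: "nat \<Rightarrow> nat \<Rightarrow> complex mat \<Rightarrow> complex mat" where
  "reduced_state d s \<rho> = ptrace_snd d (d\<^sup>2) (sub_to_front d s \<rho>)"

definition tripartite_M :: "real \<Rightarrow> real \<Rightarrow> nat \<Rightarrow> nat \<Rightarrow> nat \<Rightarrow> complex mat \<Rightarrow> complex mat" where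
  "tripartite_M \<alpha> \<beta> l d s \<rho> = bipartite_M \<alpha> \<beta> l d (d\<^sup>2) (sub_to_front d s \<rho>)"

definition mean_M_norm :: "real \<Rightarrow> real \<Rightarrow> nat \<Rightarrow> nat \<Rightarrow> complex mat \<Rightarrow> real" where
  "mean_M_norm \<alpha> \<beta> l d \<rho> = 1 / 3 *
     (trace_norm (tripartite_M \<alpha> \<beta> l d 1 \<rho>)
      + trace_norm (tripartite_M \<alpha> \<beta> l d 2 \<rho>)
      + trace_norm (tripartite_M \<alpha> \<beta> l d 3 \<rho>))"

definition pure_state :: "nat \<Rightarrow> complex vec \<Rightarrow> bool" where
  "pure_state n \<phi> \<longleftrightarrow> \<phi> \<in> carrier_vec n \<and> \<phi> \<bullet>c \<phi> = 1"

definition ket_bra :: "complex vec \<Rightarrow> complex mat" where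
  "ket_bra \<phi> = mat (dim_vec \<phi>) (dim_vec \<phi>) (\<lambda>(r, c). \<phi> $ r * cnj (\<phi> $ c))"

definition gme_concurrence_pure :: "nat \<Rightarrow> complex vec \<Rightarrow> real" where
  "gme_concurrence_pure d \<phi> =
     sqrt (Min ((\<lambda>s. 1 - Re (mat_trace (reduced_state d s (ket_bra \<phi>) * reduced_state d s (ket_bra \<phi>))))
                 ` {1, 2, 3}))"

definition is_ensemble ::
  "nat \<Rightarrow> complex mat \<Rightarrow> nat \<Rightarrow> (nat \<Rightarrow> real) \<Rightarrow> (nat \<Rightarrow> complex vec) \<Rightarrow> bool" where
  "is_ensemble N \<rho> n p \<phi> \<longleftrightarrow>
     (\<forall>i<n. 0 \<le> p i \<and> pure_state N (\<phi> i)) \<and> (\<Sum>i<n. p i) = 1 \<and>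
     \<rho> = mat N N (\<lambda>rc. \<Sum>i<n. complex_of_real (p i) * ket_bra (\<phi> i) $$ rc)"

text \<open>The minimum over all ensemble decompositions, of any finite length, is written as an infimum.
  For a density matrix the set is nonempty (spectral decomposition) and bounded below by 0, and
  the infimum is attained (compactness), so this is the minimum.\<close>

definition gme_concurrence :: "nat \<Rightarrow> complex mat \<Rightarrow> real" where
  "gme_concurrence d \<rho> =
     Inf {\<Sum>i<n. p i * gme_concurrence_pure d (\<phi> i) | n p \<phi>. is_ensemble (d ^ 3) \<rho> n p \<phi>}"

end

theory Submission
  imports Defs "HOL-Analysis.L2_Norm"
begin

text \<open>If \<open>A\<close> is a sum of rank-one matrices \<open>x\<^sub>q y\<^sub>q\<^sup>T\<close>, then its trace norm is at most the sum of the
  \<open>\<parallel>x\<^sub>q\<parallel> \<parallel>y\<^sub>q\<parallel>\<close>: pair \<open>A\<close> with its singular vectors and use the inequalities of Bessel and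
  Cauchy-Schwarz. For a pure state with Schmidt decomposition \<open>\<phi> = \<Sum>\<^sub>k u\<^sub>k \<otimes> b\<^sub>k\<close>, where
  \<open>\<parallel>b\<^sub>k\<parallel>\<^sup>2 = \<mu>\<^sub>k\<close>, the realigned matrix is the sum over \<open>(k, k')\<close> of rank-one terms of norm
  \<open>\<surd>(\<mu>\<^sub>k \<mu>\<^sub>k\<^sub>')\<close>, and the borders can be absorbed in the terms with \<open>k = k'\<close>. These diagonal
  terms contribute \<open>\<surd>((l\<alpha>\<^sup>2 + 1)(l\<beta>\<^sup>2 + 1))\<close> in total; the other ones contribute
  \<open>\<Sum>\<^bsub>k \<noteq> k'\<^esub> \<surd>(\<mu>\<^sub>k \<mu>\<^sub>k\<^sub>')\<close>, which is at most \<open>d - 1\<close> and, by Cauchy-Schwarz, at most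
  \<open>\<surd>(d(d - 1)) \<surd>(1 - tr \<rho>\<^sub>A\<^sup>2)\<close>. The first bound is used for two of the cuts and the second one for
  the cut that attains the concurrence. Since the matrix is linear in a state of trace 1, the
  rank-one sums of the members of an ensemble add up to one for the mixed state.\<close>

section \<open>Diagonalization of Hermitian matrices\<close>

lemma index_mult_mat_sum:
  assumes "A \<in> carrier_mat r n" "B \<in> carrier_mat n c" "i < r" "j < c"
  shows "(A * B) $$ (i, j) = (\<Sum>k<n. A $$ (i, k) * B $$ (k, j))"
  using assms by (auto simp: scalar_prod_def lessThan_atLeast0)

lemma mat_adjoint_eq_mat:
  "mat_adjoint A = mat (dim_col A) (dim_row A) (\<lambda>(i, j). cnj (A $$ (j, i)))"
  by (intro eq_matI) (auto simp: mat_adjoint_def mat_of_rows_def conjugate_complex_def)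

lemma mat_adjoint_carrier [simp]: "A \<in> carrier_mat r c \<Longrightarrow> mat_adjoint (A :: complex mat) \<in> carrier_mat c r"
  by (auto simp: mat_adjoint_eq_mat)

lemma index_mat_adjoint [simp]:
  "i < dim_col A \<Longrightarrow> j < dim_row A \<Longrightarrow> mat_adjoint A $$ (i, j) = cnj (A $$ (j, i))"
  by (simp add: mat_adjoint_eq_mat)

lemma dim_mat_adjoint [simp]:
  "dim_row (mat_adjoint (A :: complex mat)) = dim_col A" "dim_col (mat_adjoint A) = dim_row A"
  by (auto simp: mat_adjoint_eq_mat)

lemma mat_adjoint_mult:
  assumes "A \<in> carrier_mat r n" "B \<in> carrier_mat n c"
  shows "mat_adjoint (A * B) = mat_adjoint B * mat_adjoint (A :: complex mat)"
  using assms by (intro eq_matI) (auto simp: scalar_prod_def mult.commute intro!: sum.cong)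

definition real_diag :: "nat \<Rightarrow> (nat \<Rightarrow> real) \<Rightarrow> complex mat" where
  "real_diag n d = mat n n (\<lambda>(i, j). if i = j then complex_of_real (d i) else 0)"

lemma real_diag_carrier [simp]: "real_diag n d \<in> carrier_mat n n"
  by (simp add: real_diag_def)

lemma real_diag_mult_left:
  assumes "X \<in> carrier_mat n c" "i < n" "j < c"
  shows "(real_diag n d * X) $$ (i, j) = complex_of_real (d i) * X $$ (i, j)"
proof -
  have "(real_diag n d * X) $$ (i, j) = (\<Sum>k<n. real_diag n d $$ (i, k) * X $$ (k, j))"
    using assms by (intro index_mult_mat_sum) auto
  also have "\<dots> = (\<Sum>k<n. if k = i then complex_of_real (d i) * X $$ (i, j) else 0)"
    using assms by (intro sum.cong) (auto simp: real_diag_def)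
  finally show ?thesis using assms by simp
qed

lemma real_diag_mult_right:
  assumes "X \<in> carrier_mat r n" "i < r" "j < n"
  shows "(X * real_diag n d) $$ (i, j) = X $$ (i, j) * complex_of_real (d j)"
proof -
  have "(X * real_diag n d) $$ (i, j) = (\<Sum>k<n. X $$ (i, k) * real_diag n d $$ (k, j))"
    using assms by (intro index_mult_mat_sum) auto
  also have "\<dots> = (\<Sum>k<n. if k = j then X $$ (i, j) * complex_of_real (d j) else 0)"
    using assms by (intro sum.cong) (auto simp: real_diag_def)
  finally show ?thesis using assms by simp
qed

text \<open>The Householder reflection along \<open>v - e\<^sub>m\<close>, where \<open>e\<^sub>m\<close> is the last basis vector.\<close>

lemma householder:
  fixes v :: "nat \<Rightarrow> complex" and t :: real
  assumes unit: "(\<Sum>i<Suc m. v i * cnj (v i)) = 1" and vm: "v m = complex_of_real t" "t \<le> 0"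
  obtains H where "H \<in> carrier_mat (Suc m) (Suc m)" "mat_adjoint H = H" "H * H = 1\<^sub>m (Suc m)"
    "\<And>i. i < Suc m \<Longrightarrow> H $$ (i, m) = v i"
proof -
  \<comment> \<open>The reflection is the identity minus \<open>c\<close> times the projection-like
    matrix \<open>w i * cnj (w j)\<close>, with \<open>w = v - e_m\<close>. Because
    \<open>v m\<close> is real, \<open>w\<close> has squared norm \<open>2 (1 - t)\<close>, so
    \<open>c = 1 / (1 - t)\<close> is 2 over that squared norm; \<open>t \<le> 0\<close> keeps
    \<open>1 - t\<close> positive.\<close>
  define w where "w = (\<lambda>i. v i - (if i = m then 1 else 0))"
  define c where "c = complex_of_real (1 / (1 - t))"
  have cc: "cnj c = c" by (simp add: c_def)
  have c1: "c * (1 - complex_of_real t) = 1"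
  proof -
    have "complex_of_real (1 / (1 - t) * (1 - t)) = 1" using vm by simp
    thus ?thesis unfolding c_def of_real_mult of_real_diff by simp
  qed
  have "(\<Sum>i<m. w i * cnj (w i)) = (\<Sum>i<m. v i * cnj (v i))"
    by (intro sum.cong) (auto simp: w_def)
  also have "\<dots> = 1 - complex_of_real t * complex_of_real t"
    using unit by (simp add: vm eq_diff_eq)
  finally have ww: "(\<Sum>i<Suc m. w i * cnj (w i)) = 2 * (1 - complex_of_real t)"
    by (simp add: w_def vm) (simp add: algebra_simps)
  define H where "H = mat (Suc m) (Suc m) (\<lambda>(i, j). (if i = j then 1 else 0) - c * w i * cnj (w j))"
  have H: "H \<in> carrier_mat (Suc m) (Suc m)" by (simp add: H_def)
  have "mat_adjoint H = H"
    by (intro eq_matI) (auto simp: H_def cc mult_ac)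
  moreover have "H * H = 1\<^sub>m (Suc m)"
  proof (rule eq_matI)
    fix i j assume "i < dim_row (1\<^sub>m (Suc m) :: complex mat)" "j < dim_col (1\<^sub>m (Suc m) :: complex mat)"
    hence ij: "i < Suc m" "j < Suc m" by auto
    let ?\<delta> = "\<lambda>i j. (if i = j then 1 else 0 :: complex)"
    have "(H * H) $$ (i, j) = (\<Sum>k<Suc m. H $$ (i, k) * H $$ (k, j))"
      by (rule index_mult_mat_sum) (use H ij in auto)
    also have "\<dots> = (\<Sum>k<Suc m. (if i = k then ?\<delta> i j else 0) - (if k = i then c * w i * cnj (w j) else 0)
       - (if k = j then c * w i * cnj (w j) else 0) + c * c * w i * cnj (w j) * (w k * cnj (w k)))"
      by (rule sum.cong) (use ij in \<open>auto simp: H_def algebra_simps\<close>)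
    also have "\<dots> = ?\<delta> i j - c * w i * cnj (w j) - c * w i * cnj (w j)
        + c * c * w i * cnj (w j) * (\<Sum>k<Suc m. w k * cnj (w k))"
      unfolding sum.distrib sum_subtractf sum_distrib_left[symmetric]
      using ij by (simp add: sum.delta del: sum.lessThan_Suc)
    also have "\<dots> = ?\<delta> i j - c * w i * cnj (w j) - c * w i * cnj (w j)
        + 2 * (c * (1 - complex_of_real t)) * c * w i * cnj (w j)"
      unfolding ww by (simp add: algebra_simps)
    also have "\<dots> = ?\<delta> i j" unfolding c1 by simp
    finally show "(H * H) $$ (i, j) = 1\<^sub>m (Suc m) $$ (i, j)" using ij by simp
  qed (use H in auto)
  moreover have "H $$ (i, m) = v i" if "i < Suc m" for i
  proof -
    have "H $$ (i, m) = (if i = m then 1 else 0) + w i * (c * (1 - complex_of_real t))"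
      using that vm by (simp add: H_def w_def algebra_simps)
    also have "\<dots> = v i" unfolding c1 by (simp add: w_def)
    finally show ?thesis .
  qed
  ultimately show ?thesis using that H by blast
qed

text \<open>The characteristic polynomial is not constant, so it has a root by the fundamental
  theorem of algebra. An eigenvector is then rescaled in length and in phase, so that its last
  coordinate is real and nonpositive, as \<open>householder\<close> requires.\<close>

lemma exists_unit_eigenvector:
  fixes A :: "complex mat"
  assumes A: "A \<in> carrier_mat (Suc m) (Suc m)"
  obtains v t k where "(\<Sum>i<Suc m. v i * cnj (v i)) = 1" "v m = complex_of_real t" "t \<le> 0"
    "\<And>i. i < Suc m \<Longrightarrow> (\<Sum>j<Suc m. A $$ (i, j) * v j) = k * v i"
proof -
  have "degree (char_poly A) = Suc m" using degree_monic_char_poly[OF A] by simp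
  hence "\<not> constant (poly (char_poly A))"
    by (simp add: constant_degree)
  then obtain k where "poly (char_poly A) k = 0"
    using fundamental_theorem_of_algebra by blast
  hence "eigenvalue A k" using eigenvalue_root_char_poly[OF A] by simp
  then obtain u where u: "u \<in> carrier_vec (Suc m)" "u \<noteq> 0\<^sub>v (Suc m)" "A *\<^sub>v u = k \<cdot>\<^sub>v u"
    using A by (auto simp: eigenvalue_def eigenvector_def)
  have Au: "(\<Sum>j<Suc m. A $$ (i, j) * u $ j) = k * u $ i" if "i < Suc m" for i
    using arg_cong[OF u(3), of "\<lambda>x. x $ i"] u(1) A that
    by (simp add: scalar_prod_def lessThan_atLeast0 del: sum.op_ivl_Suc)
  define N where "N = (\<Sum>i<Suc m. (cmod (u $ i))\<^sup>2)"
  obtain i0 where "i0 < Suc m" "u $ i0 \<noteq> 0"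
    using u by (metis carrier_vecD eq_vecI index_zero_vec)
  hence N: "N > 0" unfolding N_def by (intro sum_pos2[of _ i0]) auto
  \<comment> \<open>Division by \<open>sqrt N\<close> normalizes, and the phase turns
    \<open>u $ m\<close> into \<open>- cmod (u $ m)\<close>. If \<open>u $ m = 0\<close> every phase
    would do, and 1 is taken.\<close>
  define z where "z = (if u $ m = 0 then 1 else - cnj (u $ m) / cmod (u $ m)) / sqrt N"
  define t where "t = - cmod (u $ m) / sqrt N"
  have z: "z * cnj z = 1 / complex_of_real N"
    using N unfolding z_def
    by (auto simp: complex_norm_square[symmetric] power2_eq_square norm_divide
        simp flip: of_real_mult)
  show ?thesis
  proof (rule that[of "\<lambda>i. z * u $ i" t k])
    have "(\<Sum>i<Suc m. z * u $ i * cnj (z * u $ i)) = z * cnj z * (\<Sum>i<Suc m. u $ i * cnj (u $ i))"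
      unfolding sum_distrib_left by (intro sum.cong) (auto simp: mult_ac)
    also have "(\<Sum>i<Suc m. u $ i * cnj (u $ i)) = complex_of_real N"
      unfolding N_def of_real_sum by (intro sum.cong) (auto simp: complex_norm_square simp flip: of_real_power)
    finally show "(\<Sum>i<Suc m. z * u $ i * cnj (z * u $ i)) = 1" using z N by simp
    show "z * u $ m = complex_of_real t"
    proof (cases "u $ m = 0")
      case False
      have "cnj (u $ m) * u $ m = complex_of_real (cmod (u $ m)) * cmod (u $ m)"
        by (simp add: complex_norm_square[symmetric] mult.commute power2_eq_square flip: of_real_mult)
      then show ?thesis using False N by (simp add: z_def t_def field_simps)
    qed (simp add: z_def t_def)
    show "t \<le> 0" using N by (simp add: t_def)
    fix i assume "i < Suc m"
    have "(\<Sum>j<Suc m. A $$ (i, j) * (z * u $ j)) = z * (\<Sum>j<Suc m. A $$ (i, j) * u $ j)"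
      unfolding sum_distrib_left by (intro sum.cong) (auto simp: mult_ac)
    thus "(\<Sum>j<Suc m. A $$ (i, j) * (z * u $ j)) = k * (z * u $ i)"
      using Au[OF \<open>i < Suc m\<close>] by simp
  qed
qed

text \<open>Induction on the dimension. A Householder reflection sends the last basis vector to a
  unit eigenvector; the conjugated matrix is still Hermitian, so its last row and column vanish
  outside the corner, and the induction hypothesis diagonalizes the remaining block.\<close>

theorem hermitian_diagonalization:
  assumes "A \<in> carrier_mat n n" "mat_adjoint A = A"
  obtains U d where "U \<in> carrier_mat n n" "mat_adjoint U * U = 1\<^sub>m n"
    "A = U * real_diag n d * mat_adjoint U"
  using assms
proof (induction n arbitrary: A thesis)
  case 0
  show ?case
    by (rule "0.prems"(1)[of "1\<^sub>m 0" "\<lambda>_. 0"]) (use "0.prems"(2) in \<open>auto intro!: eq_matI\<close>)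
next
  case (Suc m)
  note A = Suc.prems(2) and herm = Suc.prems(3)
  let ?n = "Suc m"
  obtain v t k where v: "(\<Sum>i<?n. v i * cnj (v i)) = 1" "v m = complex_of_real t" "t \<le> 0"
    and ev: "\<And>i. i < ?n \<Longrightarrow> (\<Sum>j<?n. A $$ (i, j) * v j) = k * v i"
    using exists_unit_eigenvector[OF A] by blast
  obtain H where H: "H \<in> carrier_mat ?n ?n" "mat_adjoint H = H" "H * H = 1\<^sub>m ?n"
    and Hv: "\<And>i. i < ?n \<Longrightarrow> H $$ (i, m) = v i"
    using householder[OF v] by blast
  define A' where "A' = H * A * H"
  have A': "A' \<in> carrier_mat ?n ?n" using H A by (auto simp: A'_def)
  have herm': "mat_adjoint A' = A'"
    using H A herm by (simp add: A'_def mat_adjoint_mult[of _ ?n ?n _ ?n] assoc_mult_mat[of _ ?n ?n _ ?n _ ?n])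
  have AH: "(A * H) $$ (i, m) = k * H $$ (i, m)" if "i < ?n" for i
  proof -
    have "(A * H) $$ (i, m) = (\<Sum>j<?n. A $$ (i, j) * H $$ (j, m))"
      by (rule index_mult_mat_sum) (use A H that in auto)
    also have "\<dots> = (\<Sum>j<?n. A $$ (i, j) * v j)" by (intro sum.cong) (auto simp: Hv)
    finally show ?thesis using ev[OF that] Hv[OF that] by simp
  qed
  have A'm: "A' $$ (i, m) = (if i = m then k else 0)" if "i < ?n" for i
  proof -
    have "A' = H * (A * H)" unfolding A'_def using A H by (simp add: assoc_mult_mat[of _ ?n ?n _ ?n _ ?n])
    hence "A' $$ (i, m) = (\<Sum>j<?n. H $$ (i, j) * (A * H) $$ (j, m))"
      using index_mult_mat_sum[of H ?n ?n "A * H" ?n i m] A H that by auto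
    also have "\<dots> = (\<Sum>j<?n. H $$ (i, j) * (k * H $$ (j, m)))"
      by (intro sum.cong) (auto simp: AH)
    also have "\<dots> = k * (H * H) $$ (i, m)"
      using index_mult_mat_sum[of H ?n ?n H ?n i m] H(1) that
      by (auto simp: sum_distrib_left mult_ac simp del: sum.lessThan_Suc)
    finally show ?thesis using H(3) that by auto
  qed
  have A'cnj: "A' $$ (i, j) = cnj (A' $$ (j, i))" if "i < ?n" "j < ?n" for i j
    using arg_cong[OF herm', of "\<lambda>X. X $$ (i, j)"] A' that by simp
  have kreal: "k = complex_of_real (Re k)"
    using A'cnj[of m m] A'm[of m] by (simp add: complex_eq_iff)
  define A'' where "A'' = mat m m (\<lambda>(i, j). A' $$ (i, j))"
  have "A'' \<in> carrier_mat m m" "mat_adjoint A'' = A''"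
    using A'cnj[symmetric] by (auto simp: A''_def intro!: eq_matI)
  then obtain U d where U: "U \<in> carrier_mat m m" "mat_adjoint U * U = 1\<^sub>m m"
    and A''eq: "A'' = U * real_diag m d * mat_adjoint U"
    using Suc.IH by blast
  have A''c: "A'' \<in> carrier_mat m m" by (simp add: A''_def)
  \<comment> \<open>The eigenvalue that was split off goes to the last position, and
    \<open>V\<close> extends \<open>U\<close> by fixing the last basis vector.\<close>
  define d' where "d' = d(m := Re k)"
  define V where "V = four_block_mat U (0\<^sub>m m 1) (0\<^sub>m 1 m) (1\<^sub>m 1)"
  have V: "V \<in> carrier_mat ?n ?n" using U by (auto simp: V_def)
  have Vadj: "mat_adjoint V = four_block_mat (mat_adjoint U) (0\<^sub>m m 1) (0\<^sub>m 1 m) (1\<^sub>m 1)"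
    using U by (intro eq_matI) (auto simp: V_def)
  have D: "real_diag ?n d' = four_block_mat (real_diag m d) (0\<^sub>m m 1) (0\<^sub>m 1 m) (k \<cdot>\<^sub>m 1\<^sub>m 1)"
    by (intro eq_matI) (use kreal in \<open>auto simp: real_diag_def d'_def less_Suc_eq\<close>)
  have A'm2: "A' $$ (m, j) = (if j = m then k else 0)" if "j < ?n" for j
    using A'cnj[of m j] A'm[OF that] kreal that by (cases "j = m") auto
  have A'block: "A' = four_block_mat A'' (0\<^sub>m m 1) (0\<^sub>m 1 m) (k \<cdot>\<^sub>m 1\<^sub>m 1)"
    by (intro eq_matI) (use A' A'm A'm2 in \<open>auto simp: A''_def less_Suc_eq\<close>)
  have UD: "U * real_diag m d \<in> carrier_mat m m" using U by (intro mult_carrier_mat) auto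
  have block_mult: "four_block_mat X (0\<^sub>m m 1) (0\<^sub>m 1 m) (x \<cdot>\<^sub>m 1\<^sub>m 1) * four_block_mat Y (0\<^sub>m m 1) (0\<^sub>m 1 m) (y \<cdot>\<^sub>m 1\<^sub>m 1)
      = four_block_mat (X * Y) (0\<^sub>m m 1) (0\<^sub>m 1 m) ((x * y) \<cdot>\<^sub>m 1\<^sub>m 1)"
    if XY: "X \<in> carrier_mat m m" "Y \<in> carrier_mat m m" for X Y :: "complex mat" and x y
  proof -
    have "0\<^sub>m 1 m * Y + x \<cdot>\<^sub>m 1\<^sub>m 1 * 0\<^sub>m 1 m = 0\<^sub>m 1 m"
         "X * 0\<^sub>m m 1 + 0\<^sub>m m 1 * (y \<cdot>\<^sub>m 1\<^sub>m 1) = 0\<^sub>m m 1"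
         "X * Y + 0\<^sub>m m 1 * 0\<^sub>m 1 m = X * Y"
         "0\<^sub>m 1 m * 0\<^sub>m m 1 + x \<cdot>\<^sub>m 1\<^sub>m 1 * (y \<cdot>\<^sub>m 1\<^sub>m 1) = (x * y) \<cdot>\<^sub>m (1\<^sub>m 1 :: complex mat)"
      using XY by (auto intro!: eq_matI simp: scalar_prod_def)
    then show ?thesis
      using XY by (subst mult_four_block_mat[where ?nr1.0=m and ?n1.0=m and ?n2.0=1 and ?nr2.0=1 and ?nc1.0=m and ?nc2.0=1]) auto
  qed
  \<comment> \<open>Writes the corner 1 as a scalar multiple, so that \<open>block_mult\<close> also
    applies to \<open>V\<close> and its adjoint.\<close>
  have one: "four_block_mat X (0\<^sub>m m 1) (0\<^sub>m 1 m) (1\<^sub>m 1) = four_block_mat X (0\<^sub>m m 1) (0\<^sub>m 1 m) (1 \<cdot>\<^sub>m 1\<^sub>m 1)"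
    for X :: "complex mat"
    by (intro arg_cong2[where f = "four_block_mat X (0\<^sub>m m 1)"]) auto
  have "V * real_diag ?n d' = four_block_mat (U * real_diag m d) (0\<^sub>m m 1) (0\<^sub>m 1 m) ((1 * k) \<cdot>\<^sub>m 1\<^sub>m 1)"
    unfolding V_def D one[of U] by (rule block_mult[OF U(1) real_diag_carrier])
  hence A'eq: "A' = V * real_diag ?n d' * mat_adjoint V"
    using block_mult[OF UD mat_adjoint_carrier[OF U(1)], of k 1]
    unfolding Vadj one[of "mat_adjoint U"] A'block A''eq by simp
  have "mat_adjoint V * V = four_block_mat (1\<^sub>m m) (0\<^sub>m m 1) (0\<^sub>m 1 m) ((1 * 1) \<cdot>\<^sub>m 1\<^sub>m 1)"
    using block_mult[OF mat_adjoint_carrier[OF U(1)] U(1), of 1 1]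
    unfolding Vadj unfolding V_def one[of U] one[of "mat_adjoint U"] U(2) .
  hence VV: "mat_adjoint V * V = 1\<^sub>m ?n"
    by (simp only:) (intro eq_matI; auto)
  show ?case
  proof (rule Suc.prems(1)[of "H * V" d'])
    show "H * V \<in> carrier_mat ?n ?n" using H V by auto
    have adj: "mat_adjoint (H * V) = mat_adjoint V * H"
      using H V by (simp add: mat_adjoint_mult[of _ ?n ?n _ ?n])
    have "mat_adjoint (H * V) * (H * V) = mat_adjoint V * ((H * H) * V)"
      unfolding adj using H(1) V by (simp add: assoc_mult_mat[of _ ?n ?n _ ?n _ ?n])
    thus "mat_adjoint (H * V) * (H * V) = 1\<^sub>m ?n" using H V VV by simp
    have "A = (H * H) * A * (H * H)" using H A by simp
    also have "\<dots> = H * A' * H"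
      unfolding A'_def using H(1) A by (simp add: assoc_mult_mat[of _ ?n ?n _ ?n _ ?n])
    also have "\<dots> = H * V * real_diag ?n d' * mat_adjoint (H * V)"
      unfolding adj A'eq using H(1) V
      by (simp add: assoc_mult_mat[of _ ?n ?n _ ?n _ ?n] mult_carrier_mat[of _ ?n ?n])
    finally show "A = H * V * real_diag ?n d' * mat_adjoint (H * V)" .
  qed
qed

section \<open>Positive semidefinite matrices and square roots\<close>

lemma quadratic_form_sum:
  assumes "A \<in> carrier_mat n n" "v \<in> carrier_vec n"
  shows "(A *\<^sub>v v) \<bullet>c v = (\<Sum>i<n. \<Sum>j<n. cnj (v $ i) * A $$ (i, j) * v $ j)"
  using assms
  by (auto simp: scalar_prod_def sum_distrib_left sum_distrib_right conjugate_complex_def lessThan_atLeast0 mult_ac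
      intro!: sum.cong)

lemma cnj_mult_self_nonneg: "0 \<le> cnj z * z"
  by (simp add: less_eq_complex_def)

lemma real_diag_one [simp]:
  "1\<^sub>m n * real_diag n d = real_diag n d" "real_diag n d * 1\<^sub>m n = real_diag n d"
  by (rule left_mult_one_mat[OF real_diag_carrier] right_mult_one_mat[OF real_diag_carrier])+

lemma dim_real_diag [simp]: "dim_row (real_diag n d) = n" "dim_col (real_diag n d) = n"
  by (simp_all add: real_diag_def)

lemma index_real_diag [simp]:
  "i < n \<Longrightarrow> j < n \<Longrightarrow> real_diag n d $$ (i, j) = (if i = j then complex_of_real (d i) else 0)"
  by (simp add: real_diag_def)

lemma real_diag_mult: "real_diag n d * real_diag n e = real_diag n (\<lambda>i. d i * e i)"
  by (intro eq_matI) (auto simp: real_diag_mult_left[of _ n n] simp del: index_mult_mat(1))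

lemma psd_mat_iff:
  "psd_mat n A \<longleftrightarrow> A \<in> carrier_mat n n \<and>
     (\<forall>v. 0 \<le> (\<Sum>i<n. \<Sum>j<n. cnj (v i) * A $$ (i, j) * v j))"
proof (cases "A \<in> carrier_mat n n")
  case True
  have "(\<forall>v \<in> carrier_vec n. 0 \<le> (A *\<^sub>v v) \<bullet>c v) \<longleftrightarrow>
     (\<forall>v. 0 \<le> (\<Sum>i<n. \<Sum>j<n. cnj (v i) * A $$ (i, j) * v j))"
  proof (intro iffI allI ballI)
    fix v assume "\<forall>v \<in> carrier_vec n. 0 \<le> (A *\<^sub>v v) \<bullet>c v"
    hence "0 \<le> (A *\<^sub>v vec n v) \<bullet>c vec n v" by simp
    thus "0 \<le> (\<Sum>i<n. \<Sum>j<n. cnj (v i) * A $$ (i, j) * v j)"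
      using quadratic_form_sum[OF True, of "vec n v"] by simp
  qed (simp add: quadratic_form_sum[OF True])
  with True show ?thesis by (simp add: psd_mat_def)
qed (simp add: psd_mat_def)

lemma sum_two_points:
  fixes f :: "nat \<Rightarrow> complex"
  assumes "a < n" "b < n" "a \<noteq> b"
  shows "(\<Sum>i<n. (if i = a then x else if i = b then y else 0) * f i) = x * f a + y * f b"
proof -
  have "(\<Sum>i<n. (if i = a then x else if i = b then y else 0) * f i)
      = (\<Sum>i<n. (if i = a then x * f a else 0) + (if i = b then y * f b else 0))"
    using assms by (intro sum.cong) auto
  thus ?thesis using assms by (simp add: sum.distrib)
qed

text \<open>Polarization: the quadratic form takes real values. On \<open>e_a\<close> this makes the
  diagonal real; on \<open>e_a + e_b\<close> and \<open>e_a + i e_b\<close> it compares the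
  imaginary and the real parts of the entries \<open>(a, b)\<close> and
  \<open>(b, a)\<close>.\<close>

lemma psd_mat_hermitian:
  assumes "psd_mat n A"
  shows "mat_adjoint A = A"
proof (rule eq_matI)
  have A: "A \<in> carrier_mat n n" using assms by (simp add: psd_mat_def)
  fix a b assume "a < dim_row A" "b < dim_col A"
  hence ab: "a < n" "b < n" using A by auto
  define Q where "Q v = (\<Sum>i<n. \<Sum>j<n. cnj (v i) * A $$ (i, j) * v j)" for v
  have Q: "Im (Q v) = 0" for v
    using assms by (simp add: psd_mat_iff Q_def less_eq_complex_def)
  show "mat_adjoint A $$ (a, b) = A $$ (a, b)"
  proof (cases "a = b")
    case True
    have "Q (\<lambda>i. if i = a then 1 else 0) = (\<Sum>i<n. if i = a then A $$ (a, a) else 0)"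
      unfolding Q_def by (intro sum.cong) (use ab in \<open>auto simp: if_distrib[of "\<lambda>x. _ * x"] cong: if_cong\<close>)
    hence "Im (A $$ (a, a)) = 0" using Q[of "\<lambda>i. if i = a then 1 else 0"] ab by simp
    thus ?thesis using True A ab by (simp add: complex_eq_iff)
  next
    case False
    have Q2: "Q (\<lambda>i. if i = a then x else if i = b then y else 0)
        = cnj x * (x * A $$ (a, a) + y * A $$ (a, b)) + cnj y * (x * A $$ (b, a) + y * A $$ (b, b))" for x y
    proof -
      let ?v = "\<lambda>i. if i = a then x else if i = b then y else 0"
      have "Q ?v = (\<Sum>i<n. (if i = a then cnj x else if i = b then cnj y else 0) * (\<Sum>j<n. ?v j * A $$ (i, j)))"
        unfolding Q_def sum_distrib_left by (intro sum.cong) (auto simp: mult_ac)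
      thus ?thesis using ab False by (simp add: sum_two_points)
    qed
    have "Im (A $$ (a, a)) = 0" "Im (A $$ (b, b)) = 0"
      using Q2[of 1 0] Q2[of 0 1] Q by (metis (no_types, lifting) complex_cnj_one complex_cnj_zero mult_zero_left mult_1 add.right_neutral add.left_neutral)+
    moreover have "Im (A $$ (a, b)) = - Im (A $$ (b, a))"
      using Q[of "\<lambda>i. if i = a then 1 else if i = b then 1 else 0"] calculation unfolding Q2 by simp
    moreover have "Re (A $$ (a, b)) = Re (A $$ (b, a))"
      using Q[of "\<lambda>i. if i = a then 1 else if i = b then \<i> else 0"] calculation unfolding Q2 by simp
    ultimately show ?thesis using A ab by (simp add: complex_eq_iff)
  qed
qed (use assms in \<open>auto simp: psd_mat_def\<close>)

text \<open>The quadratic form at \<open>v\<close> is the squared norm of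
  \<open>A v\<close>.\<close>

lemma psd_mat_adjoint_mult:
  assumes "A \<in> carrier_mat r n"
  shows "psd_mat n (mat_adjoint A * A)"
  unfolding psd_mat_iff
proof (intro conjI allI)
  show G: "mat_adjoint A * A \<in> carrier_mat n n" using assms by auto
  fix v :: "nat \<Rightarrow> complex"
  let ?y = "\<lambda>a. \<Sum>j<n. A $$ (a, j) * v j"
  have "(\<Sum>i<n. \<Sum>j<n. cnj (v i) * (mat_adjoint A * A) $$ (i, j) * v j)
      = (\<Sum>i<n. \<Sum>j<n. \<Sum>a<r. cnj (A $$ (a, i) * v i) * (A $$ (a, j) * v j))"
  proof (intro sum.cong refl)
    fix i j assume "i \<in> {..<n}" "j \<in> {..<n}"
    hence ij: "i < n" "j < n" by auto
    have "(mat_adjoint A * A) $$ (i, j) = (\<Sum>a<r. cnj (A $$ (a, i)) * A $$ (a, j))"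
      using index_mult_mat_sum[of "mat_adjoint A" n r A n i j] assms ij by auto
    thus "cnj (v i) * (mat_adjoint A * A) $$ (i, j) * v j
      = (\<Sum>a<r. cnj (A $$ (a, i) * v i) * (A $$ (a, j) * v j))"
      by (simp add: sum_distrib_left sum_distrib_right mult_ac)
  qed
  also have "\<dots> = (\<Sum>i<n. \<Sum>a<r. \<Sum>j<n. cnj (A $$ (a, i) * v i) * (A $$ (a, j) * v j))"
    by (intro sum.cong refl sum.swap)
  also have "\<dots> = (\<Sum>a<r. \<Sum>i<n. \<Sum>j<n. cnj (A $$ (a, i) * v i) * (A $$ (a, j) * v j))"
    by (rule sum.swap)
  also have "\<dots> = (\<Sum>a<r. cnj (?y a) * ?y a)"
    by (simp add: sum_product)
  also have "\<dots> \<ge> 0"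
    by (intro sum_nonneg cnj_mult_self_nonneg)
  finally show "0 \<le> (\<Sum>i<n. \<Sum>j<n. cnj (v i) * (mat_adjoint A * A) $$ (i, j) * v j)" .
qed

text \<open>Each eigenvalue is the value of the quadratic form at the corresponding column of
  \<open>U\<close>, hence nonnegative.\<close>

lemma psd_mat_diagonalization:
  assumes "psd_mat n A"
  obtains U d where "U \<in> carrier_mat n n" "mat_adjoint U * U = 1\<^sub>m n" "U * mat_adjoint U = 1\<^sub>m n"
    "A = U * real_diag n d * mat_adjoint U" "\<And>i. i < n \<Longrightarrow> 0 \<le> d i"
proof -
  have A: "A \<in> carrier_mat n n" using assms by (simp add: psd_mat_def)
  obtain U d where U: "U \<in> carrier_mat n n" "mat_adjoint U * U = 1\<^sub>m n"
    and AU: "A = U * real_diag n d * mat_adjoint U"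
    using hermitian_diagonalization[OF A psd_mat_hermitian[OF assms]] by blast
  have U': "U * mat_adjoint U = 1\<^sub>m n"
    using mat_mult_left_right_inverse[OF _ U(1) U(2)] U(1) by simp
  have "0 \<le> d i" if i: "i < n" for i
  proof -
    have "mat_adjoint U * (A * U) = (mat_adjoint U * U) * real_diag n d * (mat_adjoint U * U)"
      unfolding AU using U(1)
      by (simp add: assoc_mult_mat[of _ n n _ n _ n] mult_carrier_mat[of _ n n])
    hence D: "mat_adjoint U * (A * U) = real_diag n d" using U(2) by simp
    have "complex_of_real (d i) = (\<Sum>a<n. cnj (U $$ (a, i)) * (A * U) $$ (a, i))"
      using index_mult_mat_sum[of "mat_adjoint U" n n "A * U" n i i] A U(1) i
      unfolding D by (auto simp: real_diag_def)
    also have "\<dots> = (\<Sum>a<n. \<Sum>b<n. cnj (U $$ (a, i)) * A $$ (a, b) * U $$ (b, i))"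
      using index_mult_mat_sum[of A n n U n _ i] A U(1) i
      by (intro sum.cong refl) (auto simp: sum_distrib_left mult_ac)
    also have "\<dots> \<ge> 0" using assms by (auto simp: psd_mat_iff dest: spec[of _ "\<lambda>b. U $$ (b, i)"])
    finally show ?thesis by (simp add: less_eq_complex_def)
  qed
  with U U' AU show ?thesis using that by blast
qed

lemma index_conjugated_diag:
  assumes U: "U \<in> carrier_mat n n" and "i < n" "j < n"
  shows "(U * real_diag n d * mat_adjoint U) $$ (i, j)
    = (\<Sum>k<n. complex_of_real (d k) * U $$ (i, k) * cnj (U $$ (j, k)))"
proof -
  have "(U * real_diag n d * mat_adjoint U) $$ (i, j)
    = (\<Sum>k<n. (U * real_diag n d) $$ (i, k) * mat_adjoint U $$ (k, j))"
    by (rule index_mult_mat_sum) (use assms in \<open>auto simp: mult_carrier_mat[of _ n n]\<close>)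
  thus ?thesis using assms by (simp add: real_diag_mult_right[of _ n] mult_ac del: index_mult_mat(1))
qed

lemma psd_mat_conjugated_diag:
  assumes "U \<in> carrier_mat n n" "\<And>i. i < n \<Longrightarrow> 0 \<le> d i"
  shows "psd_mat n (U * real_diag n d * mat_adjoint U)"
  unfolding psd_mat_iff
proof (intro conjI allI)
  show "U * real_diag n d * mat_adjoint U \<in> carrier_mat n n"
    using assms by (auto simp: mult_carrier_mat[of _ n n])
  fix v :: "nat \<Rightarrow> complex"
  let ?y = "\<lambda>k. \<Sum>j<n. cnj (U $$ (j, k)) * v j"
  have "(\<Sum>i<n. \<Sum>j<n. cnj (v i) * (U * real_diag n d * mat_adjoint U) $$ (i, j) * v j)
      = (\<Sum>i<n. \<Sum>j<n. \<Sum>k<n. complex_of_real (d k) * (cnj (cnj (U $$ (i, k)) * v i) * (cnj (U $$ (j, k)) * v j)))"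
    using assms by (intro sum.cong refl)
      (simp add: index_conjugated_diag sum_distrib_left sum_distrib_right mult_ac del: index_mult_mat(1))
  also have "\<dots> = (\<Sum>i<n. \<Sum>k<n. \<Sum>j<n. complex_of_real (d k) * (cnj (cnj (U $$ (i, k)) * v i) * (cnj (U $$ (j, k)) * v j)))"
    by (intro sum.cong refl sum.swap)
  also have "\<dots> = (\<Sum>k<n. \<Sum>i<n. \<Sum>j<n. complex_of_real (d k) * (cnj (cnj (U $$ (i, k)) * v i) * (cnj (U $$ (j, k)) * v j)))"
    by (rule sum.swap)
  also have "\<dots> = (\<Sum>k<n. complex_of_real (d k) * (cnj (?y k) * ?y k))"
    by (simp only: cnj_sum sum_product, simp only: sum_distrib_left)
  also have "\<dots> \<ge> 0"
    by (intro sum_nonneg mult_nonneg_nonneg[OF _ cnj_mult_self_nonneg]) (use assms(2) in \<open>auto simp: less_eq_complex_def\<close>)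
  finally show "0 \<le> (\<Sum>i<n. \<Sum>j<n. cnj (v i) * (U * real_diag n d * mat_adjoint U) $$ (i, j) * v j)" .
qed

lemma conjugated_diag_square:
  assumes U: "U \<in> carrier_mat n n" "mat_adjoint U * U = 1\<^sub>m n"
  shows "(U * real_diag n d * mat_adjoint U) * (U * real_diag n d * mat_adjoint U)
    = U * real_diag n (\<lambda>i. (d i)\<^sup>2) * mat_adjoint U"
proof -
  have "(U * real_diag n d * mat_adjoint U) * (U * real_diag n d * mat_adjoint U)
    = U * (real_diag n d * (mat_adjoint U * U) * real_diag n d) * mat_adjoint U"
    using U(1) by (simp add: assoc_mult_mat[of _ n n _ n _ n] mult_carrier_mat[of _ n n])
  also have "real_diag n d * (mat_adjoint U * U) * real_diag n d = real_diag n (\<lambda>i. (d i)\<^sup>2)"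
    unfolding U(2) by (simp add: real_diag_mult power2_eq_square)
  finally show ?thesis .
qed

section \<open>Uniqueness of the positive semidefinite square root\<close>

text \<open>Diagonalize both matrices and let \<open>X\<close> be the change of basis between the
  two eigenbases. Equality of the squares reads \<open>d\<^sup>2 X = X e\<^sup>2\<close> entrywise;
  where an entry of \<open>X\<close> is nonzero, the nonnegative numbers \<open>d i\<close> and
  \<open>e j\<close> have equal squares and so agree. Hence \<open>d X = X e\<close>, which says
  that the two matrices are equal.\<close>

lemma psd_mat_square_inject:
  assumes B: "psd_mat n B" and C: "psd_mat n C" and eq: "B * B = C * C"
  shows "B = C"
proof -
  obtain U d where U: "U \<in> carrier_mat n n" "mat_adjoint U * U = 1\<^sub>m n" "U * mat_adjoint U = 1\<^sub>m n"
    and BU: "B = U * real_diag n d * mat_adjoint U" and d: "\<And>i. i < n \<Longrightarrow> 0 \<le> d i"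
    using psd_mat_diagonalization[OF B] by blast
  obtain V e where V: "V \<in> carrier_mat n n" "mat_adjoint V * V = 1\<^sub>m n" "V * mat_adjoint V = 1\<^sub>m n"
    and CV: "C = V * real_diag n e * mat_adjoint V" and e: "\<And>i. i < n \<Longrightarrow> 0 \<le> e i"
    using psd_mat_diagonalization[OF C] by blast
  note simps = assoc_mult_mat[of _ n n _ n _ n] mult_carrier_mat[of _ n n]
  define X where "X = mat_adjoint U * V"
  have X: "X \<in> carrier_mat n n" using U V by (auto simp: X_def simps)
  have twist: "mat_adjoint U * (U * real_diag n f * mat_adjoint U) * V = real_diag n f * X"
    "mat_adjoint U * (V * real_diag n f * mat_adjoint V) * V = X * real_diag n f" for f
  proof -
    have "mat_adjoint U * (U * real_diag n f * mat_adjoint U) * V = (mat_adjoint U * U) * real_diag n f * X"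
      using U(1) V(1) by (simp add: simps X_def)
    thus "mat_adjoint U * (U * real_diag n f * mat_adjoint U) * V = real_diag n f * X" using U(2) by simp
    have "mat_adjoint U * (V * real_diag n f * mat_adjoint V) * V = X * real_diag n f * (mat_adjoint V * V)"
      using U(1) V(1) by (simp add: simps X_def)
    thus "mat_adjoint U * (V * real_diag n f * mat_adjoint V) * V = X * real_diag n f"
      using V(2) X by (simp add: simps right_mult_one_mat[of _ n n])
  qed
  have sq: "real_diag n (\<lambda>i. (d i)\<^sup>2) * X = X * real_diag n (\<lambda>i. (e i)\<^sup>2)"
    using eq twist unfolding BU CV conjugated_diag_square[OF U(1,2)] conjugated_diag_square[OF V(1,2)] by metis
  have DX: "real_diag n d * X = X * real_diag n e"
  proof (rule eq_matI)
    fix i j assume "i < dim_row (X * real_diag n e)" "j < dim_col (X * real_diag n e)"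
    hence ij: "i < n" "j < n" using X by (auto simp: real_diag_def)
    have "complex_of_real ((d i)\<^sup>2) * X $$ (i, j) = X $$ (i, j) * complex_of_real ((e j)\<^sup>2)"
      using arg_cong[OF sq, of "\<lambda>Y. Y $$ (i, j)"] X ij
      by (simp add: real_diag_mult_left[of _ n n] real_diag_mult_right[of _ n n] del: index_mult_mat(1))
    hence "X $$ (i, j) = 0 \<or> (d i)\<^sup>2 = (e j)\<^sup>2"
      by (metis mult.commute mult_cancel_right of_real_eq_iff)
    hence "X $$ (i, j) = 0 \<or> d i = e j" using d[OF ij(1)] e[OF ij(2)] by auto
    thus "(real_diag n d * X) $$ (i, j) = (X * real_diag n e) $$ (i, j)"
      using X ij by (auto simp: real_diag_mult_left[of _ n n] real_diag_mult_right[of _ n n] simp del: index_mult_mat(1))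
  qed (use X in \<open>auto simp: real_diag_def\<close>)
  have "B = U * (real_diag n d * X) * mat_adjoint V"
  proof -
    have "U * (real_diag n d * X) * mat_adjoint V = U * real_diag n d * mat_adjoint U * (V * mat_adjoint V)"
      using U(1) V(1) by (simp add: simps X_def)
    thus ?thesis unfolding BU V(3) using U(1) by (simp add: simps right_mult_one_mat[of _ n n])
  qed
  also have "\<dots> = C"
  proof -
    have "U * (X * real_diag n e) * mat_adjoint V = (U * mat_adjoint U) * (V * real_diag n e * mat_adjoint V)"
      using U(1) V(1) by (simp add: simps X_def)
    thus ?thesis unfolding DX CV U(3) using V(1) by (simp add: simps left_mult_one_mat[of _ n n])
  qed
  finally show ?thesis .
qed

text \<open>By uniqueness the description in \<open>psd_sqrt\<close> is proper, so exhibiting any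
  positive semidefinite root evaluates it.\<close>

lemma psd_sqrt_eqI:
  assumes "psd_mat n B" "B * B = A"
  shows "psd_sqrt A = B"
proof -
  have n: "dim_row A = n" using assms by (auto simp: psd_mat_def)
  show ?thesis unfolding psd_sqrt_def n
    by (rule the_equality) (use assms psd_mat_square_inject in blast)+
qed

section \<open>Orthogonal families of vectors\<close>

text \<open>Parseval's identity for vectors that are orthogonal but not normalized. The squared
  norms \<open>e k\<close> may differ from 1 and may vanish, so it serves orthonormal bases and
  unnormalized Schmidt vectors alike.\<close>

lemma sum_orthogonal_expansion:
  fixes w :: "nat \<Rightarrow> nat \<Rightarrow> complex" and e :: "nat \<Rightarrow> real"
  assumes orth: "\<And>k l. k < n \<Longrightarrow> l < n \<Longrightarrow>
      (\<Sum>a<r. w k a * cnj (w l a)) = (if k = l then complex_of_real (e k) else 0)"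
  shows "(\<Sum>a<r. (\<Sum>k<n. p k * w k a) * cnj (\<Sum>k<n. q k * w k a)) = (\<Sum>k<n. p k * cnj (q k) * e k)"
proof -
  have "(\<Sum>a<r. (\<Sum>k<n. p k * w k a) * cnj (\<Sum>k<n. q k * w k a))
      = (\<Sum>a<r. \<Sum>k<n. \<Sum>l<n. p k * cnj (q l) * (w k a * cnj (w l a)))"
    by (simp add: sum_product mult_ac)
  also have "\<dots> = (\<Sum>k<n. \<Sum>a<r. \<Sum>l<n. p k * cnj (q l) * (w k a * cnj (w l a)))"
    by (rule sum.swap)
  also have "\<dots> = (\<Sum>k<n. \<Sum>l<n. \<Sum>a<r. p k * cnj (q l) * (w k a * cnj (w l a)))"
    by (intro sum.cong refl sum.swap)
  also have "\<dots> = (\<Sum>k<n. \<Sum>l<n. if l = k then p k * cnj (q k) * e k else 0)"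
    unfolding sum_distrib_left[symmetric] by (intro sum.cong refl) (auto simp: orth)
  finally show ?thesis by simp
qed

lemma bessel_inequality:
  fixes w :: "nat \<Rightarrow> nat \<Rightarrow> complex" and x :: "nat \<Rightarrow> complex" and e :: "nat \<Rightarrow> real"
  assumes orth: "\<And>k l. k < n \<Longrightarrow> l < n \<Longrightarrow>
      (\<Sum>a<r. w k a * cnj (w l a)) = (if k = l then complex_of_real (e k) else 0)"
    and e: "\<And>k. k < n \<Longrightarrow> e k \<le> 1"
  shows "(\<Sum>k<n. (cmod (\<Sum>a<r. cnj (w k a) * x a))\<^sup>2) \<le> (\<Sum>a<r. (cmod (x a))\<^sup>2)"
proof -
  define c where "c k = (\<Sum>a<r. cnj (w k a) * x a)" for k
  define p where "p a = (\<Sum>k<n. c k * w k a)" for a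
  have xp: "(\<Sum>a<r. x a * cnj (p a)) = (\<Sum>k<n. c k * cnj (c k))"
  proof -
    have "(\<Sum>a<r. x a * cnj (p a)) = (\<Sum>a<r. \<Sum>k<n. cnj (c k) * (cnj (w k a) * x a))"
      by (simp add: p_def sum_distrib_left mult_ac)
    also have "\<dots> = (\<Sum>k<n. \<Sum>a<r. cnj (c k) * (cnj (w k a) * x a))" by (rule sum.swap)
    also have "\<dots> = (\<Sum>k<n. c k * cnj (c k))"
      unfolding sum_distrib_left[symmetric] c_def[symmetric] by (simp add: mult.commute)
    finally show ?thesis .
  qed
  have pp: "(\<Sum>a<r. p a * cnj (p a)) = (\<Sum>k<n. c k * cnj (c k) * e k)"
    unfolding p_def by (rule sum_orthogonal_expansion[OF orth])
  have "(\<Sum>a<r. (x a - p a) * cnj (x a - p a))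
      = (\<Sum>a<r. x a * cnj (x a)) - (\<Sum>a<r. x a * cnj (p a)) - cnj (\<Sum>a<r. x a * cnj (p a)) + (\<Sum>a<r. p a * cnj (p a))"
    by (simp add: algebra_simps sum.distrib sum_subtractf)
  also have "\<dots> = (\<Sum>a<r. x a * cnj (x a)) - 2 * (\<Sum>k<n. c k * cnj (c k)) + (\<Sum>k<n. c k * cnj (c k) * e k)"
    unfolding xp pp by (simp add: mult_ac)
  finally have "complex_of_real (\<Sum>a<r. (cmod (x a - p a))\<^sup>2)
      = complex_of_real ((\<Sum>a<r. (cmod (x a))\<^sup>2) - 2 * (\<Sum>k<n. (cmod (c k))\<^sup>2) + (\<Sum>k<n. (cmod (c k))\<^sup>2 * e k))"
    by (simp add: complex_norm_square del: of_real_power)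
  hence "(\<Sum>a<r. (cmod (x a))\<^sup>2) - 2 * (\<Sum>k<n. (cmod (c k))\<^sup>2) + (\<Sum>k<n. (cmod (c k))\<^sup>2 * e k) \<ge> 0"
    unfolding of_real_eq_iff using sum_nonneg[of "{..<r}" "\<lambda>a. (cmod (x a - p a))\<^sup>2"] by simp
  moreover have "(\<Sum>k<n. (cmod (c k))\<^sup>2 * e k) \<le> (\<Sum>k<n. (cmod (c k))\<^sup>2)"
    by (intro sum_mono mult_left_le) (use e in auto)
  ultimately show ?thesis by (simp add: c_def)
qed

section \<open>Bounding the trace norm by rank-one sums\<close>

text \<open>The columns of \<open>U\<close> are right singular vectors and \<open>d\<close> lists
  the squared singular values; the last clause says that the images of these columns under
  \<open>A\<close> are orthogonal with squared norms \<open>d\<close>.\<close>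

lemma singular_value_basis:
  assumes A: "A \<in> carrier_mat r c"
  obtains U d where "U \<in> carrier_mat c c" "mat_adjoint U * U = 1\<^sub>m c" "U * mat_adjoint U = 1\<^sub>m c"
    "mat_adjoint A * A = U * real_diag c d * mat_adjoint U" "\<And>i. i < c \<Longrightarrow> 0 \<le> d i"
    "mat_adjoint (A * U) * (A * U) = real_diag c d"
proof -
  let ?G = "mat_adjoint A * A"
  obtain U d where U: "U \<in> carrier_mat c c" "mat_adjoint U * U = 1\<^sub>m c" "U * mat_adjoint U = 1\<^sub>m c"
    and G: "?G = U * real_diag c d * mat_adjoint U" and d: "\<And>i. i < c \<Longrightarrow> 0 \<le> d i"
    using psd_mat_diagonalization[OF psd_mat_adjoint_mult[OF A]] by blast
  have "mat_adjoint (A * U) * (A * U) = mat_adjoint U * (?G * U)"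
    using A U(1) by (simp add: mat_adjoint_mult[of A r c U c] assoc_mult_mat[of _ c c _ r _ c]
        assoc_mult_mat[of _ c r _ c _ c])
  also have "\<dots> = (mat_adjoint U * U) * real_diag c d * (mat_adjoint U * U)"
    unfolding G using U(1) by (simp add: assoc_mult_mat[of _ c c _ c _ c] mult_carrier_mat[of _ c c])
  finally have "mat_adjoint (A * U) * (A * U) = real_diag c d" using U(2) by simp
  with U G d show ?thesis using that by blast
qed

text \<open>The trace norm is the sum of the singular values \<open>s k\<close>, and
  \<open>s k\<close> is the inner product of \<open>w k\<close> with \<open>A u_k\<close>. Inserting
  the rank-one sum turns it into a sum over \<open>q\<close> of products
  \<open>P k q * Q k q\<close>; Cauchy-Schwarz over \<open>k\<close> and two uses of Bessel
  finish.\<close>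

lemma trace_norm_rank_one_sum_le:
  fixes x y :: "'k \<Rightarrow> nat \<Rightarrow> complex"
  assumes A: "A \<in> carrier_mat r c"
    and sum: "\<And>a b. a < r \<Longrightarrow> b < c \<Longrightarrow> A $$ (a, b) = (\<Sum>q\<in>K. x q a * y q b)"
  shows "trace_norm A \<le> (\<Sum>q\<in>K. L2_set (\<lambda>a. cmod (x q a)) {..<r} * L2_set (\<lambda>b. cmod (y q b)) {..<c})"
proof -
  let ?G = "mat_adjoint A * A"
  obtain U d where U: "U \<in> carrier_mat c c" "mat_adjoint U * U = 1\<^sub>m c" "U * mat_adjoint U = 1\<^sub>m c"
    and G: "?G = U * real_diag c d * mat_adjoint U" and d: "\<And>i. i < c \<Longrightarrow> 0 \<le> d i"
    and AUAU: "mat_adjoint (A * U) * (A * U) = real_diag c d"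
    using singular_value_basis[OF A] by blast
  define s where "s i = sqrt (d i)" for i
  define u where "u k a = U $$ (a, k)" for k a
  have orth: "(\<Sum>a<c. cnj (u k a) * u l a) = (if k = l then 1 else 0)" if "k < c" "l < c" for k l
    using index_mult_mat_sum[of "mat_adjoint U" c c U c k l] U that by (simp add: u_def)
  have orth': "(\<Sum>a<c. u k a * cnj (u l a)) = (if k = l then 1 else 0)" if "k < c" "l < c" for k l
    using orth[OF that(2,1)] by (cases "k = l") (auto simp: mult.commute)
  define S where "S = U * real_diag c s * mat_adjoint U"
  have "psd_mat c S" unfolding S_def
    by (rule psd_mat_conjugated_diag) (use U(1) d in \<open>simp_all add: s_def\<close>)
  moreover have "S * S = ?G"
  proof -
    have "real_diag c (\<lambda>i. (s i)\<^sup>2) = real_diag c d"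
      by (intro eq_matI) (use d in \<open>auto simp: real_diag_def s_def simp flip: of_real_power\<close>)
    thus ?thesis unfolding S_def conjugated_diag_square[OF U(1,2)] G by simp
  qed
  ultimately have "trace_norm A = Re (mat_trace S)"
    unfolding trace_norm_def using psd_sqrt_eqI by metis
  also have "mat_trace S = (\<Sum>i<c. \<Sum>k<c. complex_of_real (s k) * (u k i * cnj (u k i)))"
    unfolding mat_trace_def S_def using U(1)
    by (simp add: index_conjugated_diag u_def mult.assoc del: index_mult_mat(1))
  also have "\<dots> = (\<Sum>k<c. \<Sum>i<c. complex_of_real (s k) * (u k i * cnj (u k i)))"
    by (rule sum.swap)
  also have "\<dots> = (\<Sum>k<c. complex_of_real (s k))"
    unfolding sum_distrib_left[symmetric] by (simp add: orth')
  finally have tn: "trace_norm A = (\<Sum>k<c. s k)" by simp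
  define Au where "Au k a = (\<Sum>b<c. A $$ (a, b) * u k b)" for k a
  have AuAu: "(\<Sum>a<r. Au k a * cnj (Au l a)) = (if k = l then complex_of_real (d k) else 0)"
    if kl: "k < c" "l < c" for k l
  proof -
    have AU: "A * U \<in> carrier_mat r c" using A U by auto
    have AUe: "(A * U) $$ (a, k) = Au k a" if "a < r" "k < c" for a k
      using index_mult_mat_sum[of A r c U c a k] A U that by (simp add: Au_def u_def)
    have "(\<Sum>a<r. cnj (Au l a) * Au k a) = real_diag c d $$ (l, k)"
      using index_mult_mat_sum[of "mat_adjoint (A * U)" c r "A * U" c l k] AU U(1) A kl
      unfolding AUAU by (auto simp: AUe simp del: index_mult_mat(1))
    thus ?thesis using kl by (auto simp: real_diag_def mult.commute)
  qed
  \<comment> \<open>These are the left singular vectors. For \<open>s k = 0\<close> division by zero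
    makes \<open>w k\<close> the zero vector, whence the squared norm 0 in
    \<open>ww\<close>.\<close>
  define w where "w k a = Au k a / s k" for k a
  have ww: "(\<Sum>a<r. w k a * cnj (w l a)) = (if k = l then complex_of_real (if d k = 0 then 0 else 1) else 0)"
    if kl: "k < c" "l < c" for k l
  proof -
    have "(\<Sum>a<r. w k a * cnj (w l a)) = (\<Sum>a<r. Au k a * cnj (Au l a)) / (s k * s l)"
      by (simp add: w_def sum_divide_distrib)
    thus ?thesis using AuAu[OF kl] d[OF kl(1)] by (auto simp: s_def simp flip: of_real_mult)
  qed
  define P where "P k q = (\<Sum>a<r. cnj (w k a) * x q a)" for k q
  \<comment> \<open>The double conjugation displays \<open>Q k q\<close> as a Bessel coefficient of
    \<open>y q\<close> with respect to the conjugates of the \<open>u k\<close>.\<close>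
  define Q where "Q k q = (\<Sum>b<c. cnj (cnj (u k b)) * y q b)" for k q
  have sk: "complex_of_real (s k) = (\<Sum>q\<in>K. P k q * Q k q)" if k: "k < c" for k
  proof -
    \<comment> \<open>This is \<open>sqrt (d k) = d k / sqrt (d k)\<close>, true also for
      \<open>d k = 0\<close>.\<close>
    have "complex_of_real (s k) = (\<Sum>a<r. Au k a * cnj (Au k a)) / s k"
      using AuAu[OF k k] d[OF k] by (simp add: s_def real_div_sqrt flip: of_real_divide)
    also have "\<dots> = (\<Sum>a<r. cnj (w k a) * Au k a)"
      by (simp add: w_def sum_divide_distrib mult.commute)
    also have "\<dots> = (\<Sum>a<r. \<Sum>b<c. \<Sum>q\<in>K. (cnj (w k a) * x q a) * (cnj (cnj (u k b)) * y q b))"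
      by (intro sum.cong refl) (auto simp: Au_def sum sum_distrib_left sum_distrib_right mult_ac intro!: sum.cong)
    also have "\<dots> = (\<Sum>a<r. \<Sum>q\<in>K. \<Sum>b<c. (cnj (w k a) * x q a) * (cnj (cnj (u k b)) * y q b))"
      by (intro sum.cong refl sum.swap)
    also have "\<dots> = (\<Sum>q\<in>K. \<Sum>a<r. \<Sum>b<c. (cnj (w k a) * x q a) * (cnj (cnj (u k b)) * y q b))"
      by (rule sum.swap)
    also have "\<dots> = (\<Sum>q\<in>K. P k q * Q k q)"
      unfolding P_def Q_def sum_product ..
    finally show ?thesis .
  qed
  have "trace_norm A = (\<Sum>k<c. cmod (\<Sum>q\<in>K. P k q * Q k q))"
    unfolding tn
  proof (intro sum.cong refl)
    fix k assume k: "k \<in> {..<c}"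
    hence "0 \<le> s k" using d by (simp add: s_def)
    thus "s k = cmod (\<Sum>q\<in>K. P k q * Q k q)" using sk[of k] k by (metis lessThan_iff abs_of_nonneg norm_of_real)
  qed
  also have "\<dots> \<le> (\<Sum>k<c. \<Sum>q\<in>K. \<bar>cmod (P k q)\<bar> * \<bar>cmod (Q k q)\<bar>)"
    by (intro sum_mono order.trans[OF norm_sum]) (simp add: norm_mult)
  also have "\<dots> = (\<Sum>q\<in>K. \<Sum>k<c. \<bar>cmod (P k q)\<bar> * \<bar>cmod (Q k q)\<bar>)"
    by (rule sum.swap)
  also have "\<dots> \<le> (\<Sum>q\<in>K. L2_set (\<lambda>k. cmod (P k q)) {..<c} * L2_set (\<lambda>k. cmod (Q k q)) {..<c})"
    by (intro sum_mono L2_set_mult_ineq)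
  also have "\<dots> \<le> (\<Sum>q\<in>K. L2_set (\<lambda>a. cmod (x q a)) {..<r} * L2_set (\<lambda>b. cmod (y q b)) {..<c})"
  proof (intro sum_mono mult_mono L2_set_nonneg)
    fix q
    show "L2_set (\<lambda>k. cmod (P k q)) {..<c} \<le> L2_set (\<lambda>a. cmod (x q a)) {..<r}"
      unfolding L2_set_def P_def
      by (intro real_sqrt_le_mono bessel_inequality[where e = "\<lambda>k. if d k = 0 then 0 else 1"]) (auto simp: ww)
    show "L2_set (\<lambda>k. cmod (Q k q)) {..<c} \<le> L2_set (\<lambda>b. cmod (y q b)) {..<c}"
      unfolding L2_set_def Q_def
      by (intro real_sqrt_le_mono bessel_inequality[where e = "\<lambda>k. 1"]) (auto simp: orth)
  qed
  finally show ?thesis .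
qed

section \<open>Pure states of a bipartite system\<close>

text \<open>The \<open>u k\<close> are right singular vectors of the conjugate transpose of the
  amplitude matrix, and completeness of this basis gives the expansion. The \<open>b k\<close> stay
  unnormalized, so vanishing Schmidt coefficients need no special treatment;
  \<open>complex_of_real 1\<close> matches the orthogonality premise of
  \<open>sum_orthogonal_expansion\<close>.\<close>

lemma schmidt_decomposition:
  fixes \<psi> :: "nat \<Rightarrow> nat \<Rightarrow> complex"
  assumes unit: "(\<Sum>i<m. \<Sum>a<n. \<psi> i a * cnj (\<psi> i a)) = 1"
  obtains u b :: "nat \<Rightarrow> nat \<Rightarrow> complex" and \<mu> :: "nat \<Rightarrow> real"
  where "\<And>k l. k < m \<Longrightarrow> l < m \<Longrightarrow> (\<Sum>i<m. u k i * cnj (u l i)) = (if k = l then complex_of_real 1 else 0)"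
    and "\<And>k l. k < m \<Longrightarrow> l < m \<Longrightarrow> (\<Sum>a<n. b k a * cnj (b l a)) = (if k = l then complex_of_real (\<mu> k) else 0)"
    and "\<And>i a. i < m \<Longrightarrow> a < n \<Longrightarrow> \<psi> i a = (\<Sum>k<m. u k i * b k a)"
    and "\<And>k. k < m \<Longrightarrow> 0 \<le> \<mu> k" and "(\<Sum>k<m. \<mu> k) = 1"
proof -
  define X where "X = mat n m (\<lambda>(a, i). cnj (\<psi> i a))"
  have X: "X \<in> carrier_mat n m" by (simp add: X_def)
  obtain U \<mu> where U: "U \<in> carrier_mat m m" "mat_adjoint U * U = 1\<^sub>m m" "U * mat_adjoint U = 1\<^sub>m m"
    and \<mu>: "\<And>i. i < m \<Longrightarrow> 0 \<le> \<mu> i" and XU: "mat_adjoint (X * U) * (X * U) = real_diag m \<mu>"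
    using singular_value_basis[OF X] by metis
  define u where "u k i = U $$ (i, k)" for k i
  define b where "b k a = (\<Sum>i<m. cnj (u k i) * \<psi> i a)" for k a
  have orth: "(\<Sum>i<m. u k i * cnj (u l i)) = (if k = l then complex_of_real 1 else 0)" if "k < m" "l < m" for k l
    using index_mult_mat_sum[of "mat_adjoint U" m m U m l k] U that
    by (cases "k = l") (auto simp: u_def mult.commute)
  have complete: "(\<Sum>k<m. u k i * cnj (u k j)) = (if i = j then 1 else 0)" if "i < m" "j < m" for i j
    using index_mult_mat_sum[of U m m "mat_adjoint U" m i j] U that by (simp add: u_def)
  have XUe: "(X * U) $$ (a, k) = cnj (b k a)" if "a < n" "k < m" for a k
    using index_mult_mat_sum[of X n m U m a k] X U that by (simp add: b_def X_def u_def mult.commute)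
  have borth: "(\<Sum>a<n. b k a * cnj (b l a)) = (if k = l then complex_of_real (\<mu> k) else 0)"
    if "k < m" "l < m" for k l
    using index_mult_mat_sum[of "mat_adjoint (X * U)" m n "X * U" m k l] X U(1) that
    unfolding XU by (auto simp: XUe simp del: index_mult_mat(1))
  have exp: "\<psi> i a = (\<Sum>k<m. u k i * b k a)" if "i < m" "a < n" for i a
  proof -
    have "(\<Sum>k<m. u k i * b k a) = (\<Sum>k<m. \<Sum>j<m. \<psi> j a * (u k i * cnj (u k j)))"
      by (simp add: b_def sum_distrib_left mult_ac)
    also have "\<dots> = (\<Sum>j<m. \<Sum>k<m. \<psi> j a * (u k i * cnj (u k j)))" by (rule sum.swap)
    also have "\<dots> = (\<Sum>j<m. if i = j then \<psi> j a else 0)"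
      unfolding sum_distrib_left[symmetric] using that by (intro sum.cong refl) (simp add: complete)
    finally show ?thesis using that by simp
  qed
  have "1 = (\<Sum>i<m. \<Sum>a<n. (\<Sum>k<m. u k i * b k a) * cnj (\<Sum>k<m. u k i * b k a))"
    unfolding unit[symmetric] by (intro sum.cong refl) (simp add: exp)
  also have "\<dots> = (\<Sum>i<m. \<Sum>k<m. \<mu> k * (u k i * cnj (u k i)))"
    by (rule sum.cong[OF refl]) (subst sum_orthogonal_expansion[OF borth], simp_all add: mult_ac)
  also have "\<dots> = (\<Sum>k<m. \<Sum>i<m. \<mu> k * (u k i * cnj (u k i)))" by (rule sum.swap)
  also have "\<dots> = (\<Sum>k<m. complex_of_real (\<mu> k))"
    unfolding sum_distrib_left[symmetric] by (simp add: orth)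
  finally have "(\<Sum>k<m. \<mu> k) = 1" by (metis of_real_1 of_real_eq_iff of_real_sum)
  with orth borth exp \<mu> show ?thesis using that by blast
qed

section \<open>Index arithmetic and entries of the bordered matrix\<close>

lemma sum_lessThan_add:
  fixes f :: "nat \<Rightarrow> 'a :: comm_monoid_add"
  shows "(\<Sum>r<l + M. f r) = (\<Sum>r<l. f r) + (\<Sum>r<M. f (l + r))"
  by (induction M) (simp_all add: add.assoc)

text \<open>Writes \<open>r = j * m + i\<close>. Both the column stacking of
  \<open>vectorize\<close> and the Kronecker ordering are summed this way.\<close>

lemma sum_mod_div:
  fixes f :: "nat \<Rightarrow> nat \<Rightarrow> 'a :: comm_monoid_add"
  shows "(\<Sum>r<n * m. f (r mod m) (r div m)) = (\<Sum>j<n. \<Sum>i<m. f i j)"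
proof (induction n)
  case (Suc n)
  have "(\<Sum>r<Suc n * m. f (r mod m) (r div m))
      = (\<Sum>r<n * m. f (r mod m) (r div m)) + (\<Sum>r<m. f ((n * m + r) mod m) ((n * m + r) div m))"
    using sum_lessThan_add[of "\<lambda>r. f (r mod m) (r div m)" "n * m" m] by (simp add: add.commute)
  also have "(\<Sum>r<m. f ((n * m + r) mod m) ((n * m + r) div m)) = (\<Sum>r<m. f r n)"
    by (intro sum.cong) auto
  finally show ?case using Suc by simp
qed simp

text \<open>The entries of \<open>bipartite_M\<close> for the operator with entries
  \<open>\<langle>i a| \<rho> |j b\<rangle> = f i a j b\<close>; this makes linearity in \<open>\<rho>\<close> (of trace 1) visible.\<close>

definition bipartite_entry ::
  "real \<Rightarrow> real \<Rightarrow> nat \<Rightarrow> nat \<Rightarrow> nat \<Rightarrow> (nat \<Rightarrow> nat \<Rightarrow> nat \<Rightarrow> nat \<Rightarrow> complex) \<Rightarrow> nat \<Rightarrow> nat \<Rightarrow> complex" where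
  "bipartite_entry \<alpha> \<beta> L m n f r c =
    (if r < L then if c < L then complex_of_real (\<alpha> * \<beta>)
       else complex_of_real \<alpha> * (\<Sum>i<m. f i ((c - L) mod n) i ((c - L) div n))
     else if c < L then complex_of_real \<beta> * (\<Sum>a<n. f ((r - L) mod m) a ((r - L) div m) a)
     else f ((r - L) mod m) ((c - L) mod n) ((r - L) div m) ((c - L) div n))"

lemma bipartite_M_carrier: "bipartite_M \<alpha> \<beta> L m n \<rho> \<in> carrier_mat (L + m * m) (L + n * n)"
  by (auto simp: bipartite_M_def ones_mat_def omega_mat_def realignment_def ptrace_snd_def ptrace_fst_def)

lemma index_bipartite_M:
  assumes "r < L + m * m" "c < L + n * n"
  shows "bipartite_M \<alpha> \<beta> L m n \<rho> $$ (r, c)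
    = bipartite_entry \<alpha> \<beta> L m n (\<lambda>i a j b. \<rho> $$ (i * n + a, j * n + b)) r c"
proof -
  have m: "0 < m" if "\<not> r < L" using assms that by (cases m) auto
  have n: "0 < n" if "\<not> c < L" using assms that by (cases n) auto
  have rd: "(r - L) div m < m" if "\<not> r < L" using assms that by (intro less_mult_imp_div_less) auto
  have cd: "(c - L) div n < n" if "\<not> c < L" using assms that by (intro less_mult_imp_div_less) auto
  show ?thesis
    using assms m n rd cd
    by (auto simp: bipartite_entry_def bipartite_M_def ones_mat_def omega_mat_def realignment_def
        ptrace_snd_def ptrace_fst_def vectorize_def mat_block_def mat_of_cols_def mat_of_rows_def)
qed

text \<open>Three of the blocks are linear in the operator, but the corner is the constant
  \<open>\<alpha> * \<beta>\<close>; it is reproduced because the weights sum to 1.\<close>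

lemma bipartite_entry_convex:
  fixes p :: "nat \<Rightarrow> real"
  assumes "(\<Sum>e<N. p e) = 1"
  shows "bipartite_entry \<alpha> \<beta> L m n (\<lambda>i a j b. \<Sum>e<N. complex_of_real (p e) * f e i a j b) r c
    = (\<Sum>e<N. complex_of_real (p e) * bipartite_entry \<alpha> \<beta> L m n (f e) r c)"
proof -
  have p: "(\<Sum>e<N. complex_of_real (p e)) = 1" using assms by (metis of_real_1 of_real_sum)
  have swap: "x * (\<Sum>i<M. \<Sum>e<N. complex_of_real (p e) * g e i) = (\<Sum>e<N. complex_of_real (p e) * (x * (\<Sum>i<M. g e i)))"
    for x M and g :: "nat \<Rightarrow> nat \<Rightarrow> complex"
    by (subst sum.swap) (simp add: sum_distrib_left mult_ac)
  show ?thesis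
    by (auto simp: bipartite_entry_def swap sum_distrib_right[symmetric] p)
qed

section \<open>Estimates for the Schmidt coefficients\<close>

lemma sum_off_diagonal:
  fixes f :: "nat \<Rightarrow> nat \<Rightarrow> real"
  shows "(\<Sum>k<m. \<Sum>l<m. f k l) = (\<Sum>k<m. f k k) + (\<Sum>k<m. \<Sum>l\<in>{..<m} - {k}. f k l)"
proof -
  have "(\<Sum>l<m. f k l) = f k k + (\<Sum>l\<in>{..<m} - {k}. f k l)" if "k < m" for k
    using that by (intro sum.remove) auto
  thus ?thesis by (simp add: sum.distrib)
qed

text \<open>Bound each root by the arithmetic mean. Over all pairs the means add up to
  \<open>m\<close>, and the diagonal pairs account for 1 of this.\<close>

lemma sum_sqrt_products_le_dimension:
  fixes \<mu> :: "nat \<Rightarrow> real"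
  assumes nonneg: "\<And>k. k < m \<Longrightarrow> 0 \<le> \<mu> k" and one: "(\<Sum>k<m. \<mu> k) = 1"
  shows "(\<Sum>k<m. \<Sum>l\<in>{..<m} - {k}. sqrt (\<mu> k * \<mu> l)) \<le> real m - 1"
proof -
  have "(\<Sum>k<m. \<Sum>l\<in>{..<m} - {k}. sqrt (\<mu> k * \<mu> l)) \<le> (\<Sum>k<m. \<Sum>l\<in>{..<m} - {k}. (\<mu> k + \<mu> l) / 2)"
    by (intro sum_mono arith_geo_mean_sqrt) (auto simp: nonneg)
  moreover have "(\<Sum>k<m. \<Sum>l<m. (\<mu> k + \<mu> l) / 2) = real m"
    by (simp add: sum.distrib one add_divide_distrib flip: sum_divide_distrib sum_distrib_left)
  moreover have "(\<Sum>k<m. (\<mu> k + \<mu> k) / 2) = 1" using one by simp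
  ultimately show ?thesis using sum_off_diagonal[of "\<lambda>k l. (\<mu> k + \<mu> l) / 2" m] by simp
qed

text \<open>Cauchy-Schwarz against the constant 1 on the \<open>m (m - 1)\<close> ordered pairs with
  \<open>k \<noteq> l\<close>; the products \<open>\<mu> k * \<mu> l\<close> over these pairs add up
  to 1 minus the sum of squares.\<close>

lemma sum_sqrt_products_le_purity:
  fixes \<mu> :: "nat \<Rightarrow> real"
  assumes nonneg: "\<And>k. k < m \<Longrightarrow> 0 \<le> \<mu> k" and one: "(\<Sum>k<m. \<mu> k) = 1"
  shows "(\<Sum>k<m. \<Sum>l\<in>{..<m} - {k}. sqrt (\<mu> k * \<mu> l))
    \<le> sqrt (real m * (real m - 1)) * sqrt (1 - (\<Sum>k<m. (\<mu> k)\<^sup>2))"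
proof -
  let ?S = "Sigma {..<m} (\<lambda>k. {..<m} - {k})"
  \<comment> \<open>Ensures that the truncated subtraction in the cardinality of
    \<open>{..<m} - {k}\<close> agrees with the real number \<open>m - 1\<close>.\<close>
  have m: "m \<ge> 1" using one by (cases m) auto
  have "(\<Sum>k<m. \<Sum>l\<in>{..<m} - {k}. sqrt (\<mu> k * \<mu> l)) = (\<Sum>(k, l)\<in>?S. sqrt (\<mu> k * \<mu> l))"
    by (subst sum.Sigma) auto
  also have "\<dots> = (\<Sum>q\<in>?S. \<bar>1\<bar> * \<bar>case q of (k, l) \<Rightarrow> sqrt (\<mu> k * \<mu> l)\<bar>)"
    by (intro sum.cong) (auto simp: nonneg)
  also have "\<dots> \<le> L2_set (\<lambda>_. 1) ?S * L2_set (\<lambda>(k, l). sqrt (\<mu> k * \<mu> l)) ?S"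
    by (rule L2_set_mult_ineq)
  also have "L2_set (\<lambda>_. 1) ?S = sqrt (real m * (real m - 1))"
  proof -
    have "(\<Sum>q\<in>?S. 1\<^sup>2) = (\<Sum>k<m. \<Sum>l\<in>{..<m} - {k}. 1 :: real)"
      by (subst sum.Sigma) auto
    also have "\<dots> = real m * (real m - 1)" using m by simp
    finally show ?thesis by (simp add: L2_set_def)
  qed
  also have "L2_set (\<lambda>(k, l). sqrt (\<mu> k * \<mu> l)) ?S = sqrt (1 - (\<Sum>k<m. (\<mu> k)\<^sup>2))"
  proof -
    have "(\<Sum>q\<in>?S. (case q of (k, l) \<Rightarrow> sqrt (\<mu> k * \<mu> l))\<^sup>2) = (\<Sum>(k, l)\<in>?S. \<mu> k * \<mu> l)"
      by (intro sum.cong) (auto simp: nonneg)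
    also have "\<dots> = (\<Sum>k<m. \<Sum>l\<in>{..<m} - {k}. \<mu> k * \<mu> l)"
      by (subst sum.Sigma) auto
    also have "\<dots> = (\<Sum>k<m. \<mu> k) * (\<Sum>k<m. \<mu> k) - (\<Sum>k<m. (\<mu> k)\<^sup>2)"
      unfolding sum_product sum_off_diagonal[of "\<lambda>k l. \<mu> k * \<mu> l"] by (simp add: power2_eq_square)
    finally show ?thesis by (simp add: L2_set_def one)
  qed
  finally show ?thesis .
qed

text \<open>This is the trace of the squared reduced state on the first factor. The sum is already
  real, as its two factors are conjugate to each other; \<open>Re\<close> only changes the
  type.\<close>

definition purity :: "nat \<Rightarrow> nat \<Rightarrow> (nat \<Rightarrow> nat \<Rightarrow> complex) \<Rightarrow> real" where
  "purity m n \<psi> = Re (\<Sum>i<m. \<Sum>j<m. (\<Sum>a<n. \<psi> i a * cnj (\<psi> j a)) * (\<Sum>a<n. \<psi> j a * cnj (\<psi> i a)))"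

text \<open>The reduced state has eigenvectors \<open>u k\<close> and eigenvalues
  \<open>\<mu> k\<close>. Orthogonality of the \<open>b k\<close> yields its entries, and
  orthonormality of the conjugated \<open>u k\<close> then gives the squared norm of each
  row.\<close>

lemma purity_schmidt:
  fixes u b \<psi> :: "nat \<Rightarrow> nat \<Rightarrow> complex" and \<mu> :: "nat \<Rightarrow> real"
  assumes u: "\<And>k l. k < m \<Longrightarrow> l < m \<Longrightarrow> (\<Sum>i<m. u k i * cnj (u l i)) = (if k = l then complex_of_real 1 else 0)"
    and b: "\<And>k l. k < m \<Longrightarrow> l < m \<Longrightarrow> (\<Sum>a<n. b k a * cnj (b l a)) = (if k = l then complex_of_real (\<mu> k) else 0)"
    and exp: "\<And>i a. i < m \<Longrightarrow> a < n \<Longrightarrow> \<psi> i a = (\<Sum>k<m. u k i * b k a)"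
  shows "purity m n \<psi> = (\<Sum>k<m. (\<mu> k)\<^sup>2)"
proof -
  have rhoA: "(\<Sum>a<n. \<psi> i a * cnj (\<psi> j a)) = (\<Sum>k<m. u k i * cnj (u k j) * \<mu> k)" if "i < m" "j < m" for i j
    using sum_orthogonal_expansion[OF b, where p = "\<lambda>k. u k i" and q = "\<lambda>k. u k j"] exp that by simp
  have u': "(\<Sum>i<m. cnj (u k i) * cnj (cnj (u l i))) = (if k = l then complex_of_real 1 else 0)"
    if "k < m" "l < m" for k l
    using u[OF that(2,1)] by (cases "k = l") (auto simp: mult.commute)
  have row: "(\<Sum>j<m. (\<Sum>a<n. \<psi> i a * cnj (\<psi> j a)) * (\<Sum>a<n. \<psi> j a * cnj (\<psi> i a)))
      = (\<Sum>k<m. complex_of_real ((\<mu> k)\<^sup>2) * (u k i * cnj (u k i)))" if i: "i < m" for i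
  proof -
    have "(\<Sum>j<m. (\<Sum>a<n. \<psi> i a * cnj (\<psi> j a)) * (\<Sum>a<n. \<psi> j a * cnj (\<psi> i a)))
        = (\<Sum>j<m. (\<Sum>k<m. (u k i * \<mu> k) * cnj (u k j)) * cnj (\<Sum>k<m. (u k i * \<mu> k) * cnj (u k j)))"
      by (rule sum.cong[OF refl]) (simp add: rhoA i mult_ac)
    also have "\<dots> = (\<Sum>k<m. complex_of_real ((\<mu> k)\<^sup>2) * (u k i * cnj (u k i)))"
      by (subst sum_orthogonal_expansion[OF u']) (auto simp: power2_eq_square mult_ac)
    finally show ?thesis .
  qed
  have "(\<Sum>i<m. \<Sum>j<m. (\<Sum>a<n. \<psi> i a * cnj (\<psi> j a)) * (\<Sum>a<n. \<psi> j a * cnj (\<psi> i a)))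
      = (\<Sum>i<m. \<Sum>k<m. complex_of_real ((\<mu> k)\<^sup>2) * (u k i * cnj (u k i)))"
    by (rule sum.cong[OF refl]) (simp add: row)
  also have "\<dots> = (\<Sum>k<m. \<Sum>i<m. complex_of_real ((\<mu> k)\<^sup>2) * (u k i * cnj (u k i)))" by (rule sum.swap)
  also have "\<dots> = (\<Sum>k<m. complex_of_real ((\<mu> k)\<^sup>2))"
    unfolding sum_distrib_left[symmetric] by (simp add: u)
  also have "\<dots> = complex_of_real (\<Sum>k<m. (\<mu> k)\<^sup>2)" by simp
  finally show ?thesis unfolding purity_def by (metis Re_complex_of_real)
qed

text \<open>The Schmidt coefficients lie between 0 and 1, so squaring does not increase them. This
  will make the concurrence of a pure state nonnegative.\<close>

lemma purity_le_1:
  assumes "(\<Sum>i<m. \<Sum>a<n. \<psi> i a * cnj (\<psi> i a)) = 1"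
  shows "purity m n \<psi> \<le> 1"
proof (rule schmidt_decomposition[OF assms])
  fix u b \<mu>
  assume "\<And>k l. k < m \<Longrightarrow> l < m \<Longrightarrow> (\<Sum>i<m. u k i * cnj (u l i)) = (if k = l then complex_of_real 1 else 0)"
    and "\<And>k l. k < m \<Longrightarrow> l < m \<Longrightarrow> (\<Sum>a<n. b k a * cnj (b l a)) = (if k = l then complex_of_real (\<mu> k) else 0)"
    and "\<And>i a. i < m \<Longrightarrow> a < n \<Longrightarrow> \<psi> i a = (\<Sum>k<m. u k i * b k a)"
    and \<mu>: "\<And>k. k < m \<Longrightarrow> 0 \<le> \<mu> k" and one: "(\<Sum>k<m. \<mu> k) = 1"
  hence "purity m n \<psi> = (\<Sum>k<m. (\<mu> k)\<^sup>2)" by (intro purity_schmidt)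
  also have "\<dots> \<le> (\<Sum>k<m. \<mu> k)"
  proof (intro sum_mono)
    fix k assume k: "k \<in> {..<m}"
    have "\<mu> k \<le> 1" unfolding one[symmetric] using k \<mu> by (intro member_le_sum) auto
    thus "(\<mu> k)\<^sup>2 \<le> \<mu> k" using \<mu> k by (simp add: power2_eq_square mult_left_le)
  qed
  finally show ?thesis using one by simp
qed

section \<open>Rank-one sums for the bordered realignment\<close>

text \<open>The vector consists of \<open>L\<close> equal border entries followed by the stacked
  columns of a rank-one matrix, whose squared norm is the product of the two squared norms. It is
  used for the left factors with the \<open>u k\<close> and for the right factors with the
  \<open>b k\<close>.\<close>

lemma L2_set_bordered_vectorize:
  assumes "\<And>r. r < L \<Longrightarrow> x r = z"
    and "\<And>i j. i < m \<Longrightarrow> j < m \<Longrightarrow> x (L + (j * m + i)) = f i * cnj (g j)"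
    and "(\<Sum>i<m. f i * cnj (f i)) = complex_of_real s" and "(\<Sum>i<m. g i * cnj (g i)) = complex_of_real t"
  shows "L2_set (\<lambda>r. cmod (x r)) {..<L + m * m} = sqrt (real L * (cmod z)\<^sup>2 + s * t)"
proof -
  have st: "(\<Sum>i<m. (cmod (f i))\<^sup>2) = s" "(\<Sum>i<m. (cmod (g i))\<^sup>2) = t"
    using assms(3,4) by (simp_all add: complex_norm_square[symmetric] flip: of_real_sum of_real_power)
  have "(\<Sum>r<m * m. (cmod (x (L + r)))\<^sup>2) = (\<Sum>r<m * m. (cmod (x (L + ((r div m) * m + r mod m))))\<^sup>2)"
    by simp
  also have "\<dots> = (\<Sum>j<m. \<Sum>i<m. (cmod (x (L + (j * m + i))))\<^sup>2)"
    by (rule sum_mod_div)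
  also have "\<dots> = (\<Sum>j<m. \<Sum>i<m. (cmod (f i))\<^sup>2 * (cmod (g j))\<^sup>2)"
    by (intro sum.cong refl) (simp add: assms(2) norm_mult power_mult_distrib)
  also have "\<dots> = s * t"
    by (simp add: st flip: sum_distrib_left sum_distrib_right)
  finally show ?thesis
    by (simp add: L2_set_def sum_lessThan_add assms(1))
qed

lemma bipartite_entry_rank_one_sum:
  fixes \<psi> :: "nat \<Rightarrow> nat \<Rightarrow> complex"
  assumes unit: "(\<Sum>i<m. \<Sum>a<n. \<psi> i a * cnj (\<psi> i a)) = 1"
  obtains x y :: "nat \<times> nat \<Rightarrow> nat \<Rightarrow> complex"
  where "\<And>r c. r < L + m * m \<Longrightarrow> c < L + n * n \<Longrightarrow>
      bipartite_entry \<alpha> \<beta> L m n (\<lambda>i a j b. \<psi> i a * cnj (\<psi> j b)) r c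
        = (\<Sum>q\<in>{..<m} \<times> {..<m}. x q r * y q c)"
    and "(\<Sum>q\<in>{..<m} \<times> {..<m}. L2_set (\<lambda>r. cmod (x q r)) {..<L + m * m} * L2_set (\<lambda>c. cmod (y q c)) {..<L + n * n})
      \<le> sqrt ((real L * \<alpha>\<^sup>2 + 1) * (real L * \<beta>\<^sup>2 + 1))
        + min (real m - 1) (sqrt (real m * (real m - 1)) * sqrt (1 - purity m n \<psi>))"
proof -
  obtain u b \<mu> where
    u: "\<And>k l. k < m \<Longrightarrow> l < m \<Longrightarrow> (\<Sum>i<m. u k i * cnj (u l i)) = (if k = l then complex_of_real 1 else 0)"
    and b: "\<And>k l. k < m \<Longrightarrow> l < m \<Longrightarrow> (\<Sum>a<n. b k a * cnj (b l a)) = (if k = l then complex_of_real (\<mu> k) else 0)"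
    and exp: "\<And>i a. i < m \<Longrightarrow> a < n \<Longrightarrow> \<psi> i a = (\<Sum>k<m. u k i * b k a)"
    and \<mu>: "\<And>k. k < m \<Longrightarrow> 0 \<le> \<mu> k" and one: "(\<Sum>k<m. \<mu> k) = 1"
    by (rule schmidt_decomposition[OF unit]) blast
  have rhoA: "(\<Sum>a<n. \<psi> i a * cnj (\<psi> j a)) = (\<Sum>k<m. u k i * cnj (u k j) * \<mu> k)" if "i < m" "j < m" for i j
    using sum_orthogonal_expansion[OF b, where p = "\<lambda>k. u k i" and q = "\<lambda>k. u k j"] exp that by simp
  have rhoB: "(\<Sum>i<m. \<psi> i a * cnj (\<psi> i a')) = (\<Sum>k<m. b k a * cnj (b k a'))" if "a < n" "a' < n" for a a'
    using sum_orthogonal_expansion[OF u, where p = "\<lambda>k. b k a" and q = "\<lambda>k. b k a'"] exp that by (simp add: mult.commute)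
  have purity: "purity m n \<psi> = (\<Sum>k<m. (\<mu> k)\<^sup>2)"
    by (rule purity_schmidt[OF u b exp])
  \<comment> \<open>The weight \<open>\<mu> k\<close> goes into the border of \<open>y\<close> only:
    the corner then sums to \<open>\<alpha> * \<beta>\<close> and the lower border to
    \<open>\<beta>\<close> times the first reduced state, while in the upper border the
    \<open>b k\<close> already carry the weight. It also makes every diagonal
    \<open>y (k, k)\<close> have norm \<open>\<mu> k\<close> times
    \<open>sqrt (L \<beta>\<^sup>2 + 1)\<close>.\<close>
  define x where "x = (\<lambda>(k, k') r. if r < L then if k = k' then complex_of_real \<alpha> else 0
    else u k ((r - L) mod m) * cnj (u k' ((r - L) div m)))"
  define y where "y = (\<lambda>(k, k') c. if c < L then if k = k' then complex_of_real (\<beta> * \<mu> k) else 0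
    else b k ((c - L) mod n) * cnj (b k' ((c - L) div n)))"
  show ?thesis
  proof (rule that[of x y])
    fix r c assume rc: "r < L + m * m" "c < L + n * n"
    have rm: "(r - L) mod m < m" "(r - L) div m < m" if "\<not> r < L"
    proof -
      have "0 < m" using rc that by (cases m) auto
      thus "(r - L) mod m < m" by simp
      show "(r - L) div m < m" using rc that by (intro less_mult_imp_div_less) auto
    qed
    have cn: "(c - L) mod n < n" "(c - L) div n < n" if "\<not> c < L"
    proof -
      have "0 < n" using rc that by (cases n) auto
      thus "(c - L) mod n < n" by simp
      show "(c - L) div n < n" using rc that by (intro less_mult_imp_div_less) auto
    qed
    have one': "(\<Sum>k<m. complex_of_real (\<mu> k)) = 1" using one by (metis of_real_1 of_real_sum)
    have diag: "(\<Sum>k<m. \<Sum>k'<m. (if k = k' then g k k' else 0)) = (\<Sum>k<m. g k k)" for g :: "nat \<Rightarrow> nat \<Rightarrow> complex"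
      by (intro sum.cong refl) simp
    have "(\<Sum>q\<in>{..<m} \<times> {..<m}. x q r * y q c) = (\<Sum>k<m. \<Sum>k'<m. x (k, k') r * y (k, k') c)"
      by (simp add: sum.cartesian_product)
    also have "\<dots> = bipartite_entry \<alpha> \<beta> L m n (\<lambda>i a j b. \<psi> i a * cnj (\<psi> j b)) r c"
    proof (cases "r < L"; cases "c < L")
      assume "r < L" "c < L"
      hence "(\<Sum>k<m. \<Sum>k'<m. x (k, k') r * y (k, k') c)
          = (\<Sum>k<m. \<Sum>k'<m. (if k = k' then complex_of_real (\<alpha> * \<beta>) * \<mu> k else 0))"
        by (intro sum.cong refl) (auto simp: x_def y_def)
      also have "\<dots> = complex_of_real (\<alpha> * \<beta>)"
        unfolding diag sum_distrib_left[symmetric] one' by simp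
      finally show ?thesis using \<open>r < L\<close> \<open>c < L\<close> by (simp add: bipartite_entry_def)
    next
      assume "r < L" "\<not> c < L"
      hence "(\<Sum>k<m. \<Sum>k'<m. x (k, k') r * y (k, k') c)
          = (\<Sum>k<m. \<Sum>k'<m. (if k = k' then complex_of_real \<alpha> * (b k ((c - L) mod n) * cnj (b k' ((c - L) div n))) else 0))"
        by (intro sum.cong refl) (auto simp: x_def y_def)
      thus ?thesis using \<open>r < L\<close> \<open>\<not> c < L\<close> cn
        unfolding diag sum_distrib_left[symmetric] by (simp add: bipartite_entry_def rhoB)
    next
      assume "\<not> r < L" "c < L"
      hence "(\<Sum>k<m. \<Sum>k'<m. x (k, k') r * y (k, k') c)
          = (\<Sum>k<m. \<Sum>k'<m. (if k = k' then complex_of_real \<beta> * (u k ((r - L) mod m) * cnj (u k' ((r - L) div m)) * \<mu> k) else 0))"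
        by (intro sum.cong refl) (auto simp: x_def y_def)
      thus ?thesis using \<open>\<not> r < L\<close> \<open>c < L\<close> rm
        unfolding diag sum_distrib_left[symmetric] by (simp add: bipartite_entry_def rhoA)
    next
      assume "\<not> r < L" "\<not> c < L"
      hence "(\<Sum>k<m. \<Sum>k'<m. x (k, k') r * y (k, k') c)
          = (\<Sum>k<m. \<Sum>k'<m. (u k ((r - L) mod m) * b k ((c - L) mod n)) * cnj (u k' ((r - L) div m) * b k' ((c - L) div n)))"
        by (intro sum.cong refl) (auto simp: x_def y_def)
      also have "\<dots> = \<psi> ((r - L) mod m) ((c - L) mod n) * cnj (\<psi> ((r - L) div m) ((c - L) div n))"
        using rm[OF \<open>\<not> r < L\<close>] cn[OF \<open>\<not> c < L\<close>] by (simp add: exp sum_product)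
      finally show ?thesis using \<open>\<not> r < L\<close> \<open>\<not> c < L\<close> by (simp add: bipartite_entry_def)
    qed
    finally show "bipartite_entry \<alpha> \<beta> L m n (\<lambda>i a j b. \<psi> i a * cnj (\<psi> j b)) r c
        = (\<Sum>q\<in>{..<m} \<times> {..<m}. x q r * y q c)" by simp
  next
    have Lx: "L2_set (\<lambda>r. cmod (x (k, k') r)) {..<L + m * m} = sqrt (real L * (cmod (if k = k' then complex_of_real \<alpha> else 0))\<^sup>2 + 1 * 1)"
      if "k < m" "k' < m" for k k'
      using u that by (intro L2_set_bordered_vectorize[where f = "u k" and g = "u k'"]) (auto simp: x_def)
    have Ly: "L2_set (\<lambda>c. cmod (y (k, k') c)) {..<L + n * n} = sqrt (real L * (cmod (if k = k' then complex_of_real (\<beta> * \<mu> k) else 0))\<^sup>2 + \<mu> k * \<mu> k')"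
      if "k < m" "k' < m" for k k'
      using b that by (intro L2_set_bordered_vectorize[where f = "b k" and g = "b k'"]) (auto simp: y_def)
    let ?K = "sqrt ((real L * \<alpha>\<^sup>2 + 1) * (real L * \<beta>\<^sup>2 + 1))"
    let ?N = "\<lambda>k k'. L2_set (\<lambda>r. cmod (x (k, k') r)) {..<L + m * m} * L2_set (\<lambda>c. cmod (y (k, k') c)) {..<L + n * n}"
    have diag: "?N k k = ?K * \<mu> k" if k: "k < m" for k
    proof -
      have "?N k k = sqrt (real L * \<alpha>\<^sup>2 + 1) * sqrt ((real L * \<beta>\<^sup>2 + 1) * (\<mu> k)\<^sup>2)"
        unfolding Lx[OF k k] Ly[OF k k]
        by (simp add: norm_mult power_mult_distrib algebra_simps power2_eq_square)
      thus ?thesis using \<mu>[OF k] by (simp add: real_sqrt_mult)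
    qed
    \<comment> \<open>Off the diagonal the borders vanish, so the norms are 1 and
      \<open>sqrt (\<mu> k * \<mu> k')\<close>.\<close>
    have off: "?N k k' = sqrt (\<mu> k * \<mu> k')" if "k < m" "k' < m" "k \<noteq> k'" for k k'
      using that by (simp add: Lx Ly)
    have "(\<Sum>q\<in>{..<m} \<times> {..<m}. L2_set (\<lambda>r. cmod (x q r)) {..<L + m * m} * L2_set (\<lambda>c. cmod (y q c)) {..<L + n * n})
        = (\<Sum>k<m. \<Sum>k'<m. ?N k k')"
      by (simp add: sum.cartesian_product)
    also have "\<dots> = (\<Sum>k<m. ?N k k) + (\<Sum>k<m. \<Sum>k'\<in>{..<m} - {k}. ?N k k')"
      by (rule sum_off_diagonal)
    also have "(\<Sum>k<m. ?N k k) = (\<Sum>k<m. ?K * \<mu> k)"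
      by (intro sum.cong refl diag) simp
    also have "(\<Sum>k<m. ?K * \<mu> k) = ?K"
      unfolding sum_distrib_left[symmetric] one by simp
    also have "(\<Sum>k<m. \<Sum>k'\<in>{..<m} - {k}. ?N k k') = (\<Sum>k<m. \<Sum>k'\<in>{..<m} - {k}. sqrt (\<mu> k * \<mu> k'))"
      by (intro sum.cong refl off) auto
    also have "\<dots> \<le> min (real m - 1) (sqrt (real m * (real m - 1)) * sqrt (1 - purity m n \<psi>))"
      unfolding purity using sum_sqrt_products_le_dimension[OF \<mu> one] sum_sqrt_products_le_purity[OF \<mu> one] by simp
    finally show "(\<Sum>q\<in>{..<m} \<times> {..<m}. L2_set (\<lambda>r. cmod (x q r)) {..<L + m * m} * L2_set (\<lambda>c. cmod (y q c)) {..<L + n * n})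
      \<le> ?K + min (real m - 1) (sqrt (real m * (real m - 1)) * sqrt (1 - purity m n \<psi>))" by simp
  qed
qed

text \<open>The rank-one terms of all members are collected, with the weight \<open>p e\<close> put
  into the left factor. The minimum stays inside the sum, since the cut attaining the concurrence
  may differ from one member to the next.\<close>

lemma trace_norm_bipartite_M_le:
  fixes p :: "nat \<Rightarrow> real" and \<psi> :: "nat \<Rightarrow> nat \<Rightarrow> nat \<Rightarrow> complex"
  assumes p: "\<And>e. e < N \<Longrightarrow> 0 \<le> p e" "(\<Sum>e<N. p e) = 1"
    and unit: "\<And>e. e < N \<Longrightarrow> (\<Sum>i<m. \<Sum>a<n. \<psi> e i a * cnj (\<psi> e i a)) = 1"
    and \<rho>: "\<And>i a j b. i < m \<Longrightarrow> a < n \<Longrightarrow> j < m \<Longrightarrow> b < n \<Longrightarrow>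
      \<rho> $$ (i * n + a, j * n + b) = (\<Sum>e<N. complex_of_real (p e) * (\<psi> e i a * cnj (\<psi> e j b)))"
  shows "trace_norm (bipartite_M \<alpha> \<beta> L m n \<rho>) \<le> sqrt ((real L * \<alpha>\<^sup>2 + 1) * (real L * \<beta>\<^sup>2 + 1))
    + (\<Sum>e<N. p e * min (real m - 1) (sqrt (real m * (real m - 1)) * sqrt (1 - purity m n (\<psi> e))))"
proof -
  let ?Q = "{..<m} \<times> {..<m}"
  let ?K = "sqrt ((real L * \<alpha>\<^sup>2 + 1) * (real L * \<beta>\<^sup>2 + 1))"
  let ?B = "\<lambda>e. min (real m - 1) (sqrt (real m * (real m - 1)) * sqrt (1 - purity m n (\<psi> e)))"
  let ?nx = "\<lambda>x. L2_set (\<lambda>r. cmod (x r)) {..<L + m * m}" and ?ny = "\<lambda>y. L2_set (\<lambda>c. cmod (y c)) {..<L + n * n}"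
  define P where "P e x y \<longleftrightarrow> (\<forall>r<L + m * m. \<forall>c<L + n * n.
      bipartite_entry \<alpha> \<beta> L m n (\<lambda>i a j b. \<psi> e i a * cnj (\<psi> e j b)) r c = (\<Sum>q\<in>?Q. x q r * y q c))
      \<and> (\<Sum>q\<in>?Q. ?nx (x q) * ?ny (y q)) \<le> ?K + ?B e" for e x y
  have "\<forall>e\<in>{..<N}. \<exists>x y. P e x y"
  proof
    fix e assume "e \<in> {..<N}"
    hence e: "e < N" by simp
    show "\<exists>x y. P e x y"
    proof (rule bipartite_entry_rank_one_sum[OF unit[OF e], where \<alpha> = \<alpha> and \<beta> = \<beta> and L = L])
      fix x y
      assume "\<And>r c. r < L + m * m \<Longrightarrow> c < L + n * n \<Longrightarrow>
          bipartite_entry \<alpha> \<beta> L m n (\<lambda>i a j b. \<psi> e i a * cnj (\<psi> e j b)) r c = (\<Sum>q\<in>?Q. x q r * y q c)"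
        and "(\<Sum>q\<in>?Q. ?nx (x q) * ?ny (y q)) \<le> ?K + ?B e"
      hence "P e x y" by (simp add: P_def)
      thus ?thesis by blast
    qed
  qed
  then obtain x y where "\<forall>e\<in>{..<N}. P e (x e) (y e)"
    unfolding bchoice_iff by blast
  hence xy: "\<And>e r c. e < N \<Longrightarrow> r < L + m * m \<Longrightarrow> c < L + n * n \<Longrightarrow>
      bipartite_entry \<alpha> \<beta> L m n (\<lambda>i a j b. \<psi> e i a * cnj (\<psi> e j b)) r c = (\<Sum>q\<in>?Q. x e q r * y e q c)"
    and nxy: "\<And>e. e < N \<Longrightarrow> (\<Sum>q\<in>?Q. ?nx (x e q) * ?ny (y e q)) \<le> ?K + ?B e"
    unfolding P_def by simp_all
  let ?x = "\<lambda>(e, q) r. complex_of_real (p e) * x e q r" and ?y = "\<lambda>(e, q). y e q"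
  have "trace_norm (bipartite_M \<alpha> \<beta> L m n \<rho>) \<le> (\<Sum>eq\<in>{..<N} \<times> ?Q. ?nx (?x eq) * ?ny (?y eq))"
  proof (rule trace_norm_rank_one_sum_le[OF bipartite_M_carrier])
    fix r c assume rc: "r < L + m * m" "c < L + n * n"
    have "bipartite_M \<alpha> \<beta> L m n \<rho> $$ (r, c)
      = bipartite_entry \<alpha> \<beta> L m n (\<lambda>i a j b. \<Sum>e<N. complex_of_real (p e) * (\<psi> e i a * cnj (\<psi> e j b))) r c"
    proof -
      have "(r - L) mod m < m" "(r - L) div m < m" if "\<not> r < L"
        using rc that by (cases "m = 0"; auto intro!: less_mult_imp_div_less)+
      moreover have "(c - L) mod n < n" "(c - L) div n < n" if "\<not> c < L"
        using rc that by (cases "n = 0"; auto intro!: less_mult_imp_div_less)+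
      ultimately show ?thesis
        unfolding index_bipartite_M[OF rc] by (auto simp: bipartite_entry_def \<rho>)
    qed
    also have "\<dots> = (\<Sum>e<N. complex_of_real (p e) * (\<Sum>q\<in>?Q. x e q r * y e q c))"
      unfolding bipartite_entry_convex[OF p(2)] by (intro sum.cong refl) (simp add: xy rc)
    also have "\<dots> = (\<Sum>eq\<in>{..<N} \<times> ?Q. ?x eq r * ?y eq c)"
      by (simp add: sum.cartesian_product sum_distrib_left mult.assoc split_def)
    finally show "bipartite_M \<alpha> \<beta> L m n \<rho> $$ (r, c) = (\<Sum>eq\<in>{..<N} \<times> ?Q. ?x eq r * ?y eq c)" .
  qed
  also have "\<dots> = (\<Sum>e<N. \<Sum>q\<in>?Q. ?nx (?x (e, q)) * ?ny (?y (e, q)))"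
    by (simp only: sum.cartesian_product split_def prod.collapse)
  also have "\<dots> = (\<Sum>e<N. p e * (\<Sum>q\<in>?Q. ?nx (x e q) * ?ny (y e q)))"
  proof -
    have "?nx (?x (e, q)) = p e * ?nx (x e q)" if "e < N" for e q
      using p(1)[OF that] by (simp add: norm_mult L2_set_right_distrib)
    thus ?thesis
      by (auto simp: sum_distrib_left mult.assoc intro!: sum.cong)
  qed
  also have "\<dots> \<le> (\<Sum>e<N. p e * (?K + ?B e))"
    by (intro sum_mono mult_left_mono nxy p) auto
  also have "\<dots> = ?K + (\<Sum>e<N. p e * ?B e)"
    by (simp only: distrib_left sum.distrib p(2) flip: sum_distrib_right)
  finally show ?thesis .
qed

section \<open>The three cuts of a tripartite state\<close>

lemma tensor_index_less:
  fixes i a m n :: nat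
  assumes "i < m" "a < n"
  shows "i * n + a < m * n"
proof -
  have "i * n + a < Suc i * n" using assms by simp
  also have "\<dots> \<le> m * n" using assms by (intro mult_le_mono1) simp
  finally show ?thesis .
qed

text \<open>The map permutes the three base-\<open>d\<close> digits of an index. Digits are
  recovered by \<open>div\<close> and \<open>mod\<close>, and an injective map of a finite set into
  itself is onto.\<close>

lemma front_index_bij:
  assumes d: "0 < d" and s: "s \<in> {1, 2, 3}"
  shows "bij_betw (front_index d s) {..<d ^ 3} {..<d ^ 3}"
proof -
  have d3: "d ^ 3 = d\<^sup>2 * d" "d ^ 3 = d * d\<^sup>2" by (simp_all add: power3_eq_cube power2_eq_square)
  have tri: "tri_index d x y z < d ^ 3" if "x < d" "y < d" "z < d" for x y z
  proof -
    have "x * d + y < d\<^sup>2"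
      using tensor_index_less[OF that(1,2)] by (simp add: power2_eq_square)
    thus ?thesis unfolding tri_index_def d3(1) using that tensor_index_less by blast
  qed
  have dig: "r div d\<^sup>2 < d" "r div d mod d < d" "r mod d < d" if "r < d ^ 3" for r
    using that d by (auto simp: d3(2) intro!: less_mult_imp_div_less)
  have maps: "front_index d s ` {..<d ^ 3} \<subseteq> {..<d ^ 3}"
    using dig tri by (auto simp: front_index_def Let_def)
  have "inj_on (front_index d s) {..<d ^ 3}"
  proof (rule inj_onI)
    fix r r' assume rr: "r \<in> {..<d ^ 3}" "r' \<in> {..<d ^ 3}" and eq: "front_index d s r = front_index d s r'"
    have inj: "x = x' \<and> y = y' \<and> z = z'" if "tri_index d x y z = tri_index d x' y' z'"
      "y < d" "z < d" "y' < d" "z' < d" for x y z x' y' z'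
    proof -
      have "z = z'" "x * d + y = x' * d + y'"
        using arg_cong[OF that(1), of "\<lambda>t. t mod d"] arg_cong[OF that(1), of "\<lambda>t. t div d"] that d
        by (simp_all add: tri_index_def)
      moreover have "y = y'" "x = x'"
        using arg_cong[OF calculation(2), of "\<lambda>t. t mod d"] arg_cong[OF calculation(2), of "\<lambda>t. t div d"] that d
        by simp_all
      ultimately show ?thesis by simp
    qed
    have "r div d\<^sup>2 = r' div d\<^sup>2 \<and> r div d mod d = r' div d mod d \<and> r mod d = r' mod d"
      using eq s dig[of r] dig[of r'] rr by (auto simp: front_index_def Let_def dest!: inj)
    hence "r div d div d = r' div d div d" "r div d mod d = r' div d mod d" "r mod d = r' mod d"
      by (simp_all add: power2_eq_square div_mult2_eq)
    thus "r = r'" by (metis div_mod_decomp)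
  qed
  thus ?thesis using maps by (simp add: bij_betw_def endo_inj_surj)
qed

lemma sum_tensor_index:
  fixes f :: "nat \<Rightarrow> 'a :: comm_monoid_add"
  shows "(\<Sum>i<m. \<Sum>a<n. f (i * n + a)) = (\<Sum>r<m * n. f r)"
proof -
  have "(\<Sum>i<m. \<Sum>a<n. f (i * n + a)) = (\<Sum>r<m * n. f ((r div n) * n + r mod n))"
    by (rule sum_mod_div[symmetric])
  thus ?thesis by simp
qed

lemma index_ket_bra [simp]:
  "r < dim_vec \<phi> \<Longrightarrow> c < dim_vec \<phi> \<Longrightarrow> ket_bra \<phi> $$ (r, c) = \<phi> $ r * cnj (\<phi> $ c)"
  by (simp add: ket_bra_def)

text \<open>The amplitudes of \<open>\<phi>\<close> for the cut of subsystem \<open>s\<close> against the other two.\<close>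

definition cut :: "nat \<Rightarrow> nat \<Rightarrow> complex vec \<Rightarrow> nat \<Rightarrow> nat \<Rightarrow> complex" where
  "cut d s \<phi> i a = \<phi> $ front_index d s (i * d\<^sup>2 + a)"

lemma front_index_less:
  assumes "s \<in> {1, 2, 3}" "i < d" "a < d\<^sup>2"
  shows "front_index d s (i * d\<^sup>2 + a) < d ^ 3" "i * d\<^sup>2 + a < d ^ 3"
proof -
  show *: "i * d\<^sup>2 + a < d ^ 3"
    using tensor_index_less[OF assms(2,3)] by (simp add: power3_eq_cube power2_eq_square mult.assoc)
  show "front_index d s (i * d\<^sup>2 + a) < d ^ 3"
    using front_index_bij[of d s] assms * by (auto simp: bij_betw_def)
qed

text \<open>A cut lists the coordinates of \<open>\<phi>\<close> in another order, which leaves the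
  norm unchanged.\<close>

lemma cut_unit:
  assumes s: "s \<in> {1, 2, 3}" and \<phi>: "pure_state (d ^ 3) \<phi>" and d: "0 < d"
  shows "(\<Sum>i<d. \<Sum>a<d\<^sup>2. cut d s \<phi> i a * cnj (cut d s \<phi> i a)) = 1"
proof -
  have "(\<Sum>i<d. \<Sum>a<d\<^sup>2. cut d s \<phi> i a * cnj (cut d s \<phi> i a))
      = (\<Sum>r<d * d\<^sup>2. \<phi> $ front_index d s r * cnj (\<phi> $ front_index d s r))"
    unfolding cut_def by (rule sum_tensor_index)
  also have "\<dots> = (\<Sum>r<d ^ 3. \<phi> $ front_index d s r * cnj (\<phi> $ front_index d s r))"
    by (simp add: power3_eq_cube power2_eq_square mult.assoc)
  also have "\<dots> = (\<Sum>r<d ^ 3. \<phi> $ r * cnj (\<phi> $ r))"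
    by (rule sum.reindex_bij_betw[OF front_index_bij[OF d s]])
  also have "\<dots> = 1"
    using \<phi> by (auto simp: pure_state_def scalar_prod_def conjugate_complex_def lessThan_atLeast0)
  finally show ?thesis .
qed

text \<open>Connects the matrix form used in the concurrence with the amplitudes of the cut, to
  which the Schmidt estimates apply.\<close>

lemma purity_reduced_state:
  assumes s: "s \<in> {1, 2, 3}" and \<phi>: "\<phi> \<in> carrier_vec (d ^ 3)"
  shows "Re (mat_trace (reduced_state d s (ket_bra \<phi>) * reduced_state d s (ket_bra \<phi>))) = purity d (d\<^sup>2) (cut d s \<phi>)"
proof -
  let ?R = "reduced_state d s (ket_bra \<phi>)"
  have R: "?R \<in> carrier_mat d d" by (simp add: reduced_state_def ptrace_snd_def)
  have Re: "?R $$ (i, j) = (\<Sum>a<d\<^sup>2. cut d s \<phi> i a * cnj (cut d s \<phi> j a))" if "i < d" "j < d" for i j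
    using that \<phi> front_index_less[OF s]
    by (auto simp: reduced_state_def ptrace_snd_def sub_to_front_def cut_def intro!: sum.cong)
  have "mat_trace (?R * ?R) = (\<Sum>i<d. \<Sum>j<d. ?R $$ (i, j) * ?R $$ (j, i))"
    unfolding mat_trace_def using R index_mult_mat_sum[OF R R] by simp
  thus ?thesis by (simp add: Re purity_def)
qed

lemma gme_concurrence_pure_cases:
  assumes "\<phi> \<in> carrier_vec (d ^ 3)"
  obtains s where "s \<in> {1, 2, 3}" "gme_concurrence_pure d \<phi> = sqrt (1 - purity d (d\<^sup>2) (cut d s \<phi>))"
proof -
  let ?g = "\<lambda>s. 1 - Re (mat_trace (reduced_state d s (ket_bra \<phi>) * reduced_state d s (ket_bra \<phi>)))"
  have "Min (?g ` {1, 2, 3}) \<in> ?g ` {1, 2, 3}" by (intro Min_in) auto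
  then obtain s where s: "s \<in> {1, 2, 3}" "Min (?g ` {1, 2, 3}) = ?g s" by blast
  show ?thesis
    using that[OF s(1)] unfolding gme_concurrence_pure_def s(2) purity_reduced_state[OF s(1) assms] by blast
qed

text \<open>Moving a factor to the front turns each member of the ensemble into its cut amplitudes,
  so the bipartite bound applies with dimensions \<open>d\<close> and \<open>d\<^sup>2\<close>; its
  constants depend on the smaller one.\<close>

lemma trace_norm_tripartite_M_le:
  assumes ens: "is_ensemble (d ^ 3) \<rho> N p \<phi>" and s: "s \<in> {1, 2, 3}" and d: "0 < d"
  shows "trace_norm (tripartite_M \<alpha> \<beta> l d s \<rho>) \<le> sqrt ((real l * \<alpha>\<^sup>2 + 1) * (real l * \<beta>\<^sup>2 + 1))
    + (\<Sum>e<N. p e * min (real d - 1) (sqrt (real d * (real d - 1)) * sqrt (1 - purity d (d\<^sup>2) (cut d s (\<phi> e)))))"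
  unfolding tripartite_M_def
proof (rule trace_norm_bipartite_M_le)
  show "(\<Sum>e<N. p e) = 1" "\<And>e. e < N \<Longrightarrow> 0 \<le> p e"
    using ens by (auto simp: is_ensemble_def)
  show "(\<Sum>i<d. \<Sum>a<d\<^sup>2. cut d s (\<phi> e) i a * cnj (cut d s (\<phi> e) i a)) = 1" if "e < N" for e
    using ens that by (intro cut_unit s d) (auto simp: is_ensemble_def)
  fix i a j b assume "i < d" "a < d\<^sup>2" "j < d" "b < d\<^sup>2"
  note less = front_index_less[OF s this(1,2)] front_index_less[OF s this(3,4)]
  have "\<rho> $$ (r, c) = (\<Sum>e<N. complex_of_real (p e) * (\<phi> e $ r * cnj (\<phi> e $ c)))" if "r < d ^ 3" "c < d ^ 3" for r c
  proof -
    have \<rho>: "\<rho> = mat (d ^ 3) (d ^ 3) (\<lambda>rc. \<Sum>i<N. complex_of_real (p i) * ket_bra (\<phi> i) $$ rc)"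
      and dim: "\<And>e. e < N \<Longrightarrow> dim_vec (\<phi> e) = d ^ 3"
      using ens by (auto simp: is_ensemble_def pure_state_def)
    show ?thesis using that dim by (subst \<rho>) auto
  qed
  thus "sub_to_front d s \<rho> $$ (i * d\<^sup>2 + a, j * d\<^sup>2 + b)
      = (\<Sum>e<N. complex_of_real (p e) * (cut d s (\<phi> e) i a * cnj (cut d s (\<phi> e) j b)))"
    using less by (simp add: sub_to_front_def cut_def)
qed

section \<open>Ensembles and the final bound\<close>

text \<open>Spectral decomposition: the eigenvalues are the weights, and they sum to the trace. It
  guarantees that the infimum in \<open>gme_concurrence\<close> is over a nonempty set.\<close>

lemma density_mat_has_ensemble:
  assumes "density_mat n \<rho>"
  obtains p \<phi> where "is_ensemble n \<rho> n p \<phi>"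
proof -
  have psd: "psd_mat n \<rho>" and tr: "mat_trace \<rho> = 1" using assms by (auto simp: density_mat_def)
  have \<rho>: "\<rho> \<in> carrier_mat n n" using psd by (simp add: psd_mat_def)
  obtain U p where U: "U \<in> carrier_mat n n" "mat_adjoint U * U = 1\<^sub>m n"
    and \<rho>U: "\<rho> = U * real_diag n p * mat_adjoint U" and p: "\<And>i. i < n \<Longrightarrow> 0 \<le> p i"
    using psd_mat_diagonalization[OF psd] by metis
  have norm: "(\<Sum>a<n. U $$ (a, k) * cnj (U $$ (a, k))) = 1" if "k < n" for k
    using index_mult_mat_sum[of "mat_adjoint U" n n U n k k] U that by (simp add: mult.commute)
  have entry: "\<rho> $$ (i, j) = (\<Sum>k<n. complex_of_real (p k) * (U $$ (i, k) * cnj (U $$ (j, k))))"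
    if "i < n" "j < n" for i j
    unfolding \<rho>U using index_conjugated_diag[OF U(1) that] by (simp add: mult.assoc)
  have "1 = (\<Sum>i<n. \<Sum>k<n. complex_of_real (p k) * (U $$ (i, k) * cnj (U $$ (i, k))))"
    unfolding tr[symmetric] mat_trace_def using \<rho> by (simp add: entry)
  also have "\<dots> = (\<Sum>k<n. \<Sum>i<n. complex_of_real (p k) * (U $$ (i, k) * cnj (U $$ (i, k))))"
    by (rule sum.swap)
  also have "\<dots> = (\<Sum>k<n. complex_of_real (p k))"
    unfolding sum_distrib_left[symmetric] by (simp add: norm)
  finally have "(\<Sum>k<n. p k) = 1" by (metis of_real_1 of_real_eq_iff of_real_sum)
  moreover have "pure_state n (col U k)" if "k < n" for k
    using U(1) that norm[OF that]
    by (simp add: pure_state_def scalar_prod_def conjugate_complex_def lessThan_atLeast0)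
  moreover have "\<rho> = mat n n (\<lambda>rc. \<Sum>i<n. complex_of_real (p i) * ket_bra (col U i) $$ rc)"
    by (intro eq_matI) (use \<rho> U(1) entry in auto)
  ultimately have "is_ensemble n \<rho> n p (col U)" using p by (simp add: is_ensemble_def)
  thus ?thesis using that by blast
qed

text \<open>For the cut attaining the concurrence of \<open>\<phi>\<close> the second argument of \<open>min\<close> is used, for
  the other two cuts the first.\<close>

lemma sum_cuts_le_concurrence:
  assumes "\<phi> \<in> carrier_vec (d ^ 3)" "d \<ge> 2"
  defines "B \<equiv> \<lambda>s. min (real d - 1) (sqrt (real d * (real d - 1)) * sqrt (1 - purity d (d\<^sup>2) (cut d s \<phi>)))"
  assumes nonneg: "0 \<le> gme_concurrence_pure d \<phi>"
  shows "B 1 + B 2 + B 3 \<le> 3 * (sqrt (real d * (real d - 1)) * gme_concurrence_pure d \<phi>) + 2 * (real d - 1)"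
proof -
  let ?C = "sqrt (real d * (real d - 1)) * gme_concurrence_pure d \<phi>"
  obtain s where s: "s \<in> {1, 2, 3}" "gme_concurrence_pure d \<phi> = sqrt (1 - purity d (d\<^sup>2) (cut d s \<phi>))"
    using gme_concurrence_pure_cases[OF assms(1)] by blast
  have "B s \<le> ?C" by (simp add: B_def s(2))
  moreover have "B t \<le> real d - 1" for t by (simp add: B_def)
  from this[of 1] this[of 2] this[of 3] have "B 1 \<le> real d - 1" "B 2 \<le> real d - 1" "B 3 \<le> real d - 1" .
  \<comment> \<open>One cut contributes at most \<open>?C\<close>, which nonnegativity allows to
    enlarge to \<open>3 * ?C\<close>; the factor 3 cancels against the mean over the three
    cuts.\<close>
  moreover have "0 \<le> ?C" using nonneg assms(2) by simp
  ultimately show ?thesis using s(1) by auto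
qed

theorem theorem6:
  fixes d l :: nat and \<alpha> \<beta> :: real and \<rho> :: "complex mat"
  assumes "d \<ge> 2" and "l \<ge> 1"
    and "density_mat (d ^ 3) \<rho>"
  shows "gme_concurrence d \<rho> \<ge>
    1 / sqrt (real d * (real d - 1)) *
      (mean_M_norm \<alpha> \<beta> l d \<rho>
       - sqrt ((real l * \<alpha>\<^sup>2 + 1) * (real l * \<beta>\<^sup>2 + 1))
       - 2 * (real d - 1) / 3)"
proof -
  let ?K = "sqrt ((real l * \<alpha>\<^sup>2 + 1) * (real l * \<beta>\<^sup>2 + 1))"
  let ?D = "sqrt (real d * (real d - 1))"
  let ?rhs = "1 / ?D * (mean_M_norm \<alpha> \<beta> l d \<rho> - ?K - 2 * (real d - 1) / 3)"
  have D: "?D > 0" using assms(1) by simp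
  \<comment> \<open>The bound is shown for every ensemble separately, which makes it a lower bound
    for the infimum.\<close>
  have "?rhs \<le> (\<Sum>i<N. p i * gme_concurrence_pure d (\<phi> i))" if ens: "is_ensemble (d ^ 3) \<rho> N p \<phi>" for N p \<phi>
  proof -
    let ?C = "\<lambda>e. gme_concurrence_pure d (\<phi> e)"
    define B where "B s e = min (real d - 1) (?D * sqrt (1 - purity d (d\<^sup>2) (cut d s (\<phi> e))))" for s e
    have p: "\<And>e. e < N \<Longrightarrow> 0 \<le> p e" "(\<Sum>e<N. p e) = 1"
      and \<phi>: "\<And>e. e < N \<Longrightarrow> pure_state (d ^ 3) (\<phi> e)"
      using ens by (auto simp: is_ensemble_def)
    have tn: "trace_norm (tripartite_M \<alpha> \<beta> l d s \<rho>) \<le> ?K + (\<Sum>e<N. p e * B s e)" if "s \<in> {1, 2, 3}" for s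
      using trace_norm_tripartite_M_le[OF ens that, of \<alpha> \<beta> l] assms(1) by (simp add: B_def)
    have "3 * mean_M_norm \<alpha> \<beta> l d \<rho> \<le> 3 * ?K + (\<Sum>e<N. p e * B 1 e) + (\<Sum>e<N. p e * B 2 e) + (\<Sum>e<N. p e * B 3 e)"
      using tn[of 1] tn[of 2] tn[of 3] by (simp add: mean_M_norm_def)
    also have "\<dots> = 3 * ?K + (\<Sum>e<N. p e * (B 1 e + B 2 e + B 3 e))"
      by (simp add: distrib_left sum.distrib)
    also have "(\<Sum>e<N. p e * (B 1 e + B 2 e + B 3 e)) \<le> (\<Sum>e<N. p e * (3 * (?D * ?C e) + 2 * (real d - 1)))"
    proof (intro sum_mono mult_left_mono)
      fix e assume "e \<in> {..<N}"
      hence e: "e < N" by simp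
      hence car: "\<phi> e \<in> carrier_vec (d ^ 3)" using \<phi> by (simp add: pure_state_def)
      obtain s where s: "s \<in> {1, 2, 3}" "?C e = sqrt (1 - purity d (d\<^sup>2) (cut d s (\<phi> e)))"
        using gme_concurrence_pure_cases[OF car] by blast
      \<comment> \<open>Without this, the root in \<open>?C e\<close> could be taken of a negative
        number, and real \<open>sqrt\<close> is then negative.\<close>
      have "purity d (d\<^sup>2) (cut d s (\<phi> e)) \<le> 1"
        by (intro purity_le_1 cut_unit s(1) \<phi> e) (use assms(1) in simp)
      hence "0 \<le> ?C e" by (simp add: s(2))
      thus "B 1 e + B 2 e + B 3 e \<le> 3 * (?D * ?C e) + 2 * (real d - 1)"
        unfolding B_def by (rule sum_cuts_le_concurrence[OF car assms(1)])
    qed (use p in simp)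
    also have "(\<Sum>e<N. p e * (3 * (?D * ?C e) + 2 * (real d - 1)))
        = 3 * (?D * (\<Sum>e<N. p e * ?C e)) + 2 * (real d - 1)"
    proof -
      have "(\<Sum>e<N. p e * (3 * (?D * ?C e) + 2 * (real d - 1)))
          = (\<Sum>e<N. 3 * (?D * (p e * ?C e))) + (\<Sum>e<N. p e) * (2 * (real d - 1))"
        by (simp add: distrib_left sum.distrib sum_distrib_right mult_ac)
      thus ?thesis by (simp only: p(2) mult_1_left flip: sum_distrib_left)
    qed
    finally have "mean_M_norm \<alpha> \<beta> l d \<rho> - ?K - 2 * (real d - 1) / 3 \<le> ?D * (\<Sum>e<N. p e * ?C e)" by linarith
    thus ?thesis using D by (simp add: divide_le_eq mult.commute del: real_sqrt_gt_0_iff)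
  qed
  \<comment> \<open>Nonemptiness, required by \<open>cInf_greatest\<close>.\<close>
  moreover obtain p \<phi> where "is_ensemble (d ^ 3) \<rho> (d ^ 3) p \<phi>"
    using density_mat_has_ensemble[OF assms(3)] by blast
  ultimately show ?thesis
    unfolding gme_concurrence_def by (intro cInf_greatest) auto
qed

end
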